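(* Let $d\ge1$ and let $G$ be a graph that is rigid and totally loose in $\mathbb{R}^d$. Then $G$ can be obtained from $d$-special graphs by a sequence of clique sum operations.
   Context: A $d$-dimensional framework is a pair $(G,p)$ with $G=(V,E)$ a graph and $p:V\to\mathbb{R}^d$; it is generic if its $d|V|$ coordinates are algebraically independent over $\mathbb{Q}$. Frameworks $(G,p),(G,q)$ are equivalent if $\|p(u)-p(v)\|=\|q(u)-q(v)\|$ for all $uv\in E$, and congruent if this holds for all $u,v\in V$. $(G,p)$ is rigid if there is $\varepsilon>0$ such that every equivalent $(G,q)$ with $\|p(v)-q(v)\|<\varepsilon$ for all $v$ is congruent to $(G,p)$, and globally rigid if every equivalent $d$-dimensional framework is congruent to it. A graph is rigid (resp. globally rigid) in $\mathbb{R}^d$ if some (equivalently, every) generic realization in $\mathbb{R}^d$ is rigid (resp. globally rigid). A vertex pair $\{u,v\}$ is weakly globally linked in $G$ in $\mathbb{R}^d$ if there is a generic realization $(G,p)$ in $\mathbb{R}^d$ such that every equivalent $d$-dimensional $(G,q)$ satisfies $\|q(u)-q(v)\|=\|p(u)-p(v)\|$; otherwise it is globally loose. $G$ is totally loose in $\mathbb{R}^d$ if every non-adjacent pair is globally loose in $G$. A graph $G$ is $d$-special if it is rigid in $\mathbb{R}^d$ and every proper induced subgraph of $G$ that is rigid in $\mathbb{R}^d$ is complete. For graphs $G_1,G_2$ containing cliques $K_1\subseteq G_1$, $K_2\subseteq G_2$ on $t\ge1$ vertices, the ($t$-)clique sum along $K_1,K_2$ identifies the vertices of $K_1$ with those of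 $K_2$ via a bijection. *)

theory Defs
  imports "HOL-Analysis.Analysis"
begin

definition is_graph :: "'a set \<Rightarrow> 'a set set \<Rightarrow> bool" where
  "is_graph V E \<longleftrightarrow> finite V \<and>
     (\<forall>e\<in>E. \<exists>u v. e = {u, v} \<and> u \<noteq> v \<and> u \<in> V \<and> v \<in> V)"

definition induced_edges :: "'a set set \<Rightarrow> 'a set \<Rightarrow> 'a set set" where
  "induced_edges E S = {e \<in> E. e \<subseteq> S}"

definition is_clique :: "'a set set \<Rightarrow> 'a set \<Rightarrow> bool" where
  "is_clique E S \<longleftrightarrow> (\<forall>u\<in>S. \<forall>v\<in>S. u \<noteq> v \<longrightarrow> {u, v} \<in> E)"

text \<open>Algebraic independence over the rationals of a family of reals indexed by I:
  no nonzero polynomial with rational coefficients in finitely many of the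
  variables x i (i in I) vanishes. A polynomial is a finitely supported map
  from monomials (finitely supported exponent vectors) to its coefficients.\<close>

definition alg_indep_Q :: "('i \<Rightarrow> real) \<Rightarrow> 'i set \<Rightarrow> bool" where
  "alg_indep_Q x I \<longleftrightarrow>
     (\<forall>c :: ('i \<Rightarrow> nat) \<Rightarrow> rat.
        finite {m. c m \<noteq> 0} \<and>
        (\<forall>m. c m \<noteq> 0 \<longrightarrow> finite {i. m i \<noteq> 0} \<and> {i. m i \<noteq> 0} \<subseteq> I) \<and>
        (\<Sum>m\<in>{m. c m \<noteq> 0}. of_rat (c m) * (\<Prod>i\<in>{i. m i \<noteq> 0}. x i ^ m i)) = 0
        \<longrightarrow> (\<forall>m. c m = 0))"

definition generic :: "'a set \<Rightarrow> ('a \<Rightarrow> real^'d) \<Rightarrow> bool" where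
  "generic V p \<longleftrightarrow> alg_indep_Q (\<lambda>(v, i). p v $ i) (V \<times> UNIV)"

definition equivalent :: "'a set set \<Rightarrow> ('a \<Rightarrow> real^'d) \<Rightarrow> ('a \<Rightarrow> real^'d) \<Rightarrow> bool" where
  "equivalent E p q \<longleftrightarrow> (\<forall>u v. {u, v} \<in> E \<longrightarrow> dist (p u) (p v) = dist (q u) (q v))"

definition congruent :: "'a set \<Rightarrow> ('a \<Rightarrow> real^'d) \<Rightarrow> ('a \<Rightarrow> real^'d) \<Rightarrow> bool" where
  "congruent V p q \<longleftrightarrow> (\<forall>u\<in>V. \<forall>v\<in>V. dist (p u) (p v) = dist (q u) (q v))"

definition rigid_framework :: "'a set \<Rightarrow> 'a set set \<Rightarrow> ('a \<Rightarrow> real^'d) \<Rightarrow> bool" where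
  "rigid_framework V E p \<longleftrightarrow>
     (\<exists>\<epsilon>>0. \<forall>q. equivalent E p q \<and> (\<forall>v\<in>V. dist (p v) (q v) < \<epsilon>) \<longrightarrow> congruent V p q)"

definition rigid_graph :: "('d::finite) itself \<Rightarrow> 'a set \<Rightarrow> 'a set set \<Rightarrow> bool" where
  "rigid_graph _ V E \<longleftrightarrow> (\<exists>p :: 'a \<Rightarrow> real^'d. generic V p \<and> rigid_framework V E p)"

definition weakly_globally_linked :: "('d::finite) itself \<Rightarrow> 'a set \<Rightarrow> 'a set set \<Rightarrow> 'a \<Rightarrow> 'a \<Rightarrow> bool" where
  "weakly_globally_linked _ V E u v \<longleftrightarrow>
     (\<exists>p :: 'a \<Rightarrow> real^'d. generic V p \<and>
        (\<forall>q :: 'a \<Rightarrow> real^'d. equivalent E p q \<longrightarrow> dist (q u) (q v) = dist (p u) (p v)))"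

definition globally_loose :: "('d::finite) itself \<Rightarrow> 'a set \<Rightarrow> 'a set set \<Rightarrow> 'a \<Rightarrow> 'a \<Rightarrow> bool" where
  "globally_loose D V E u v \<longleftrightarrow> \<not> weakly_globally_linked D V E u v"

definition totally_loose :: "('d::finite) itself \<Rightarrow> 'a set \<Rightarrow> 'a set set \<Rightarrow> bool" where
  "totally_loose D V E \<longleftrightarrow>
     (\<forall>u\<in>V. \<forall>v\<in>V. u \<noteq> v \<and> {u, v} \<notin> E \<longrightarrow> globally_loose D V E u v)"

definition special :: "('d::finite) itself \<Rightarrow> 'a set \<Rightarrow> 'a set set \<Rightarrow> bool" where
  "special D V E \<longleftrightarrow> rigid_graph D V E \<and>
     (\<forall>S. S \<subset> V \<and> rigid_graph D S (induced_edges E S) \<longrightarrow> is_clique E S)"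

text \<open>Graphs obtainable from d-special graphs by clique sums. Since each summand
  embeds injectively into a clique sum, the summands can be taken as subgraphs
  (on the same vertex type) whose vertex sets meet exactly in a common nonempty
  clique K; the sum is then the union.\<close>
inductive clique_sum_of_special :: "('d::finite) itself \<Rightarrow> 'a set \<Rightarrow> 'a set set \<Rightarrow> bool"
  for D :: "('d::finite) itself" where
  base: "is_graph V E \<Longrightarrow> special D V E \<Longrightarrow> clique_sum_of_special D V E"
| sum: "clique_sum_of_special D V1 E1 \<Longrightarrow> clique_sum_of_special D V2 E2 \<Longrightarrow>
        V1 \<inter> V2 \<noteq> {} \<Longrightarrow> is_clique E1 (V1 \<inter> V2) \<Longrightarrow> is_clique E2 (V1 \<inter> V2) \<Longrightarrow>
        clique_sum_of_special D (V1 \<union> V2) (E1 \<union> E2)"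

end

theory Submission
  imports Defs "HOL-Homology.Invariance_of_Domain"
begin

text \<open>If G is not special, it has a proper rigid induced subgraph on a vertex set S that is not
  complete. Let C be a component of the complement of S. The attachment set of C in S is a clique:
  a non-adjacent pair in it lies in a rigid subgraph and is joined by a path outside that
  subgraph, which makes the pair weakly globally linked. Hence G is the clique sum of the
  subgraphs induced on the complement of C and on C with its attachment set; both are again rigid
  and totally loose, and one argues by induction on the number of vertices.

  For the weak global linkedness, take a generic framework on S whose u-v distance is minimal among
  all equivalent ones and isolated from above, and put all other vertices next to u. The path then
  forbids every larger value. That such a generic minimizer exists rests on the algebraic
  description of rigidity: squared distances are algebraic over the squared edge lengths.\<close>

subsection \<open>Rational polynomial functions and generic points\<close>

text \<open>Rigidity supplies one generic realization and weak linkedness asks for another one, so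
  information has to pass between realizations. Being algebraic over the squared edge lengths is a
  condition that mentions no realization. At a generic point it is tied to motions without Jacobian
  ranks: an algebraic value is locally determined (Rolle), and a transcendental one is changed by
  arbitrarily small motions (invariance of domain). The obstacle is the generic minimizer. A
  minimizer on the fibre of a generic framework need not be generic, and after a perturbation the
  minimal root might split into several close ones, of which the perturbed framework need not attain
  the least. An extremal choice of the multiplicity excludes this. The sides of the decomposition
  stay rigid because a motion of one side extends over the other by an isometry that agrees with it
  on the clique.\<close>

definition monom_fun :: "('i \<Rightarrow> nat) \<Rightarrow> ('i \<Rightarrow> real) \<Rightarrow> real" where
  "monom_fun m z = (\<Prod>i\<in>{i. m i \<noteq> 0}. z i ^ m i)"

text \<open>Bounding each exponent instead of the total degree makes the number of monomials an
  exact power, as the counting in \<open>card_alg_indep_le\<close> wants, while bounds still add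
  under products.\<close>

definition expo_box :: "'i set \<Rightarrow> nat \<Rightarrow> ('i \<Rightarrow> nat) set" where
  "expo_box I D = {m. {i. m i \<noteq> 0} \<subseteq> I \<and> (\<forall>i. m i \<le> D)}"

text \<open>Polynomials are taken as functions, without coefficients, over an arbitrary index type.
  The indices may thus themselves be functions, which makes algebraic relations between functions
  expressible.\<close>

inductive_set ratpoly :: "'i set \<Rightarrow> (('i \<Rightarrow> real) \<Rightarrow> real) set" for I where
  const: "(\<lambda>z. of_rat c) \<in> ratpoly I"
| var: "i \<in> I \<Longrightarrow> (\<lambda>z. z i) \<in> ratpoly I"
| add: "P \<in> ratpoly I \<Longrightarrow> Q \<in> ratpoly I \<Longrightarrow> (\<lambda>z. P z + Q z) \<in> ratpoly I"
| mult: "P \<in> ratpoly I \<Longrightarrow> Q \<in> ratpoly I \<Longrightarrow> (\<lambda>z. P z * Q z) \<in> ratpoly I"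

lemma monom_fun_eq_prod:
  assumes "finite I" "{i. m i \<noteq> 0} \<subseteq> I"
  shows "monom_fun m z = (\<Prod>i\<in>I. z i ^ m i)"
  unfolding monom_fun_def using assms by (intro prod.mono_neutral_left) auto

lemma monom_fun_mult_args:
  "monom_fun m (\<lambda>i. y i * z i) = monom_fun m y * monom_fun m z"
  by (simp add: monom_fun_def power_mult_distrib prod.distrib)

lemma monom_fun_ones: "monom_fun m (\<lambda>i. 1) = 1"
  by (simp add: monom_fun_def)

lemma monom_fun_add:
  assumes "finite {i. m i \<noteq> 0}" "finite {i. n i \<noteq> 0}"
  shows "monom_fun (\<lambda>i. m i + n i) z = monom_fun m z * monom_fun n z"
proof -
  let ?I = "{i. m i \<noteq> 0} \<union> {i. n i \<noteq> 0}"
  have f: "finite ?I" using assms by auto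
  show ?thesis
    using monom_fun_eq_prod[OF f, of m z] monom_fun_eq_prod[OF f, of n z]
      monom_fun_eq_prod[OF f, of "\<lambda>i. m i + n i" z]
    by (auto simp: power_add prod.distrib)
qed

lemma finite_support_expo_box: "finite I \<Longrightarrow> m \<in> expo_box I D \<Longrightarrow> finite {i. m i \<noteq> 0}"
  by (auto simp: expo_box_def intro: finite_subset)

lemma expo_box_mono: "D \<le> D' \<Longrightarrow> expo_box I D \<subseteq> expo_box I D'"
  by (auto simp: expo_box_def intro: order_trans)

lemma expo_box_add: "m \<in> expo_box I D \<Longrightarrow> n \<in> expo_box I D' \<Longrightarrow> (\<lambda>i. m i + n i) \<in> expo_box I (D + D')"
  by (auto simp: expo_box_def intro: add_mono)

lemma bij_betw_expo_box:
  "bij_betw (\<lambda>m. restrict m I) (expo_box I D) (I \<rightarrow>\<^sub>E {..D})"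
  unfolding bij_betw_def
proof
  show "inj_on (\<lambda>m. restrict m I) (expo_box I D)"
  proof (rule inj_onI)
    fix m n assume mn: "m \<in> expo_box I D" "n \<in> expo_box I D" "restrict m I = restrict n I"
    show "m = n"
    proof
      fix i show "m i = n i"
      proof (cases "i \<in> I")
        case True
        then show ?thesis using fun_cong[OF mn(3), of i] by simp
      next
        case False
        then have "i \<notin> {i. m i \<noteq> 0}" "i \<notin> {i. n i \<noteq> 0}"
          using mn(1,2) unfolding expo_box_def by blast+
        then show ?thesis by simp
      qed
    qed
  qed
  show "(\<lambda>m. restrict m I) ` expo_box I D = (I \<rightarrow>\<^sub>E {..D})"
  proof (intro equalityI subsetI)
    fix f assume f: "f \<in> I \<rightarrow>\<^sub>E {..D}"
    let ?m = "\<lambda>i. if i \<in> I then f i else 0"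
    have "?m \<in> expo_box I D" using f by (auto simp: expo_box_def)
    moreover have "f = restrict ?m I" using f by (auto simp: fun_eq_iff PiE_def extensional_def)
    ultimately show "f \<in> (\<lambda>m. restrict m I) ` expo_box I D" by (intro image_eqI[of f _ ?m])
  qed (auto simp: expo_box_def)
qed

lemma card_expo_box: "finite I \<Longrightarrow> card (expo_box I D) = (D + 1) ^ card I"
  using bij_betw_same_card[OF bij_betw_expo_box, of I D] by (simp add: card_PiE)

lemma finite_expo_box: "finite I \<Longrightarrow> finite (expo_box I D)"
  using bij_betw_finite[OF bij_betw_expo_box, of I D] by (simp add: finite_PiE)

text \<open>Dedekind's argument: distinct monomials are distinct characters of the multiplicative
  structure on points, hence linearly independent.\<close>

lemma monom_fun_linear_independent:
  fixes c :: "('i \<Rightarrow> nat) \<Rightarrow> real"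
  assumes "finite S" "\<And>m. m \<in> S \<Longrightarrow> finite {i. m i \<noteq> 0}"
    and "\<And>z. (\<Sum>m\<in>S. c m * monom_fun m z) = 0"
  shows "\<forall>m\<in>S. c m = 0"
  using assms
proof (induction S arbitrary: c rule: finite_induct)
  case (insert n S)
  \<comment> \<open>Evaluate the relation at the coordinatewise product of \<open>y\<close> and
    \<open>z\<close> and subtract \<open>monom_fun n y\<close> times the relation at
    \<open>z\<close>: the term of \<open>n\<close> cancels.\<close>
  have step: "(\<Sum>m\<in>S. (c m * (monom_fun m y - monom_fun n y)) * monom_fun m z) = 0" for y z
  proof -
    have 1: "c n * monom_fun n z + (\<Sum>m\<in>S. c m * monom_fun m z) = 0"
      using insert.prems(2)[of z] insert.hyps by simp
    have 2: "c n * (monom_fun n y * monom_fun n z) + (\<Sum>m\<in>S. c m * (monom_fun m y * monom_fun m z)) = 0"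
      using insert.prems(2)[of "\<lambda>i. y i * z i"] insert.hyps by (simp add: monom_fun_mult_args)
    have "(\<Sum>m\<in>S. (c m * (monom_fun m y - monom_fun n y)) * monom_fun m z)
      = (\<Sum>m\<in>S. c m * (monom_fun m y * monom_fun m z)) - monom_fun n y * (\<Sum>m\<in>S. c m * monom_fun m z)"
      by (simp add: sum_subtractf sum_distrib_left algebra_simps)
    also have "\<dots> = - (c n * (monom_fun n y * monom_fun n z)) + monom_fun n y * (c n * monom_fun n z)"
      using 1 2 by (smt (verit) mult_minus_right)
    finally show ?thesis by simp
  qed
  have S0: "c m = 0" if "m \<in> S" for m
  proof -
    have "m \<noteq> n" using that insert.hyps by auto
    then obtain i where i: "m i \<noteq> n i" by auto
    \<comment> \<open>With 2 at a coordinate where the exponents differ and 1 elsewhere, the two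
      monomials take different powers of 2.\<close>
    let ?y = "\<lambda>k. if k = i then 2 else (1::real)"
    have val: "monom_fun k ?y = 2 ^ k i" if "finite {i. k i \<noteq> 0}" for k :: "'i \<Rightarrow> nat"
    proof -
      have "monom_fun k ?y = (\<Prod>l\<in>insert i {i. k i \<noteq> 0}. ?y l ^ k l)"
        using that by (intro monom_fun_eq_prod) auto
      also have "\<dots> = (\<Prod>l\<in>insert i {i. k i \<noteq> 0}. if l = i then 2 ^ k i else 1)"
        by (intro prod.cong) auto
      also have "\<dots> = 2 ^ k i" using that by (subst prod.delta) auto
      finally show ?thesis .
    qed
    have "c m * (monom_fun m ?y - monom_fun n ?y) = 0"
      using insert.IH[of "\<lambda>m. c m * (monom_fun m ?y - monom_fun n ?y)"] step insert.prems(1) that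
      by auto
    moreover have "monom_fun m ?y \<noteq> monom_fun n ?y"
      using i that insert.prems(1) by (simp add: val)
    ultimately show ?thesis by simp
  qed
  have "c n = 0"
    using insert.prems(2)[of "\<lambda>i. 1"] insert.hyps S0 by (simp add: monom_fun_ones)
  with S0 show ?case by auto
qed auto

lemma ratpoly_mono: "I \<subseteq> J \<Longrightarrow> P \<in> ratpoly I \<Longrightarrow> P \<in> ratpoly J"
  by (rotate_tac 1, induction rule: ratpoly.induct) (auto intro: ratpoly.intros)

lemma ratpoly_0: "(\<lambda>z. 0) \<in> ratpoly I" and ratpoly_1: "(\<lambda>z. 1) \<in> ratpoly I"
  and ratpoly_of_nat: "(\<lambda>z. of_nat n) \<in> ratpoly I"
  using ratpoly.const[of 0 I] ratpoly.const[of 1 I] ratpoly.const[of "of_nat n" I] by simp_all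

lemma ratpoly_uminus: "P \<in> ratpoly I \<Longrightarrow> (\<lambda>z. - P z) \<in> ratpoly I"
  using ratpoly.mult[OF ratpoly.const[of "-1" I], of P] by (simp add: of_rat_minus)

lemma ratpoly_diff: "P \<in> ratpoly I \<Longrightarrow> Q \<in> ratpoly I \<Longrightarrow> (\<lambda>z. P z - Q z) \<in> ratpoly I"
  using ratpoly.add[OF _ ratpoly_uminus, of P I Q] by simp

lemma ratpoly_power: "P \<in> ratpoly I \<Longrightarrow> (\<lambda>z. P z ^ n) \<in> ratpoly I"
  by (induction n) (auto intro: ratpoly_1 ratpoly.mult)

lemma ratpoly_sum: "(\<And>k. k \<in> S \<Longrightarrow> P k \<in> ratpoly I) \<Longrightarrow> (\<lambda>z. \<Sum>k\<in>S. P k z) \<in> ratpoly I"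
  by (induction S rule: infinite_finite_induct) (auto intro: ratpoly_0 ratpoly.add)

lemma ratpoly_prod: "(\<And>k. k \<in> S \<Longrightarrow> P k \<in> ratpoly I) \<Longrightarrow> (\<lambda>z. \<Prod>k\<in>S. P k z) \<in> ratpoly I"
  by (induction S rule: infinite_finite_induct) (auto intro: ratpoly_1 ratpoly.mult)

lemma ratpoly_monom_fun: "{i. m i \<noteq> 0} \<subseteq> I \<Longrightarrow> monom_fun m \<in> ratpoly I"
  unfolding monom_fun_def[abs_def] by (intro ratpoly_prod ratpoly_power ratpoly.var) auto

lemma ratpoly_cong: "P \<in> ratpoly I \<Longrightarrow> (\<And>i. i \<in> I \<Longrightarrow> y i = z i) \<Longrightarrow> P y = P z"
  by (induction rule: ratpoly.induct) auto

lemma ratpoly_compose: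
  assumes "Q \<in> ratpoly J" "\<And>j. j \<in> J \<Longrightarrow> h j \<in> ratpoly I"
  shows "(\<lambda>z. Q (\<lambda>j. h j z)) \<in> ratpoly I"
  using assms by (induction rule: ratpoly.induct) (auto intro: ratpoly.intros)

lemma tendsto_ratpoly:
  assumes "Q \<in> ratpoly J" "\<And>j. j \<in> J \<Longrightarrow> ((\<lambda>z. g z j) \<longlongrightarrow> y j) F"
  shows "((\<lambda>z. Q (g z)) \<longlongrightarrow> Q y) F"
  using assms by (induction rule: ratpoly.induct) (auto intro!: tendsto_intros)

section \<open>Expansion of polynomial functions in monomials\<close>

definition monom_span :: "('i \<Rightarrow> nat) set \<Rightarrow> (('i \<Rightarrow> real) \<Rightarrow> real) set" where
  "monom_span M = {P. \<exists>c. P = (\<lambda>z. \<Sum>m\<in>M. of_rat (c m) * monom_fun m z)}"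

lemma monom_span_mono:
  assumes "finite N" "M \<subseteq> N" shows "monom_span M \<subseteq> monom_span N"
proof
  fix P assume "P \<in> monom_span M"
  then obtain c where P: "P = (\<lambda>z. \<Sum>m\<in>M. of_rat (c m) * monom_fun m z)"
    by (auto simp: monom_span_def)
  have "P = (\<lambda>z. \<Sum>m\<in>N. of_rat (if m \<in> M then c m else 0) * monom_fun m z)"
    unfolding P using assms by (intro ext sum.mono_neutral_cong_left) auto
  then show "P \<in> monom_span N"
    unfolding monom_span_def mem_Collect_eq by (rule exI[of _ "\<lambda>m. if m \<in> M then c m else 0"])
qed

lemma monom_span_add:
  assumes "P \<in> monom_span M" "Q \<in> monom_span M"
  shows "(\<lambda>z. P z + Q z) \<in> monom_span M"
proof -
  obtain c d where "P = (\<lambda>z. \<Sum>m\<in>M. of_rat (c m) * monom_fun m z)"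
    "Q = (\<lambda>z. \<Sum>m\<in>M. of_rat (d m) * monom_fun m z)"
    using assms by (auto simp: monom_span_def)
  then have "(\<lambda>z. P z + Q z) = (\<lambda>z. \<Sum>m\<in>M. of_rat (c m + d m) * monom_fun m z)"
    by (auto simp: of_rat_add sum.distrib distrib_right)
  then show ?thesis
    unfolding monom_span_def mem_Collect_eq by (rule exI[of _ "\<lambda>m. c m + d m"])
qed

lemma monom_span_mult:
  assumes I: "finite I" and P: "P \<in> monom_span (expo_box I D)" and Q: "Q \<in> monom_span (expo_box I D')"
  shows "(\<lambda>z. P z * Q z) \<in> monom_span (expo_box I (D + D'))"
proof -
  let ?M = "expo_box I D" and ?N = "expo_box I D'" and ?K = "expo_box I (D + D')"
  let ?g = "\<lambda>(m, n). (\<lambda>i. m i + n i) :: 'a \<Rightarrow> nat"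
  obtain c d where c: "P = (\<lambda>z. \<Sum>m\<in>?M. of_rat (c m) * monom_fun m z)"
    and d: "Q = (\<lambda>z. \<Sum>m\<in>?N. of_rat (d m) * monom_fun m z)"
    using P Q by (auto simp: monom_span_def)
  have fin: "finite ?M" "finite ?N" "finite ?K" using finite_expo_box[OF I] by auto
  have "P z * Q z = (\<Sum>k\<in>?K. of_rat (\<Sum>x\<in>{x \<in> ?M \<times> ?N. ?g x = k}. c (fst x) * d (snd x)) * monom_fun k z)" for z
  proof -
    have "P z * Q z = (\<Sum>(m, n)\<in>?M \<times> ?N. of_rat (c m) * monom_fun m z * (of_rat (d n) * monom_fun n z))"
      by (simp add: c d sum_product sum.cartesian_product)
    also have "\<dots> = (\<Sum>x\<in>?M \<times> ?N. of_rat (c (fst x) * d (snd x)) * monom_fun (?g x) z)"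
      by (intro sum.cong)
        (auto simp: of_rat_mult monom_fun_add[OF finite_support_expo_box[OF I] finite_support_expo_box[OF I]])
    also have "\<dots> = (\<Sum>k\<in>?K. \<Sum>x\<in>{x \<in> ?M \<times> ?N. ?g x = k}. of_rat (c (fst x) * d (snd x)) * monom_fun (?g x) z)"
      using fin by (intro sum.group[symmetric]) (auto intro: expo_box_add)
    also have "\<dots> = (\<Sum>k\<in>?K. of_rat (\<Sum>x\<in>{x \<in> ?M \<times> ?N. ?g x = k}. c (fst x) * d (snd x)) * monom_fun k z)"
      by (intro sum.cong) (auto simp: of_rat_sum sum_distrib_right)
    finally show ?thesis .
  qed
  then have "(\<lambda>z. P z * Q z) = (\<lambda>z. \<Sum>k\<in>?K. of_rat (\<Sum>x\<in>{x \<in> ?M \<times> ?N. ?g x = k}. c (fst x) * d (snd x)) * monom_fun k z)"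
    by (rule ext)
  then show ?thesis
    unfolding monom_span_def mem_Collect_eq by (rule exI[where x = "\<lambda>k. \<Sum>x\<in>{x \<in> ?M \<times> ?N. ?g x = k}. c (fst x) * d (snd x)"])
qed

lemma monom_fun_in_span:
  assumes "finite M" "n \<in> M"
  shows "(\<lambda>z. of_rat q * monom_fun n z) \<in> monom_span M"
proof -
  have "(\<lambda>z. of_rat q * monom_fun n z) = (\<lambda>z. \<Sum>m\<in>M. of_rat (if m = n then q else 0) * monom_fun m z)"
  proof
    fix z
    have "(\<Sum>m\<in>M. of_rat (if m = n then q else 0) * monom_fun m z)
        = (\<Sum>m\<in>M. if m = n then of_rat q * monom_fun n z else 0)"
      by (intro sum.cong) auto
    then show "of_rat q * monom_fun n z = (\<Sum>m\<in>M. of_rat (if m = n then q else 0) * monom_fun m z)"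
      using assms by simp
  qed
  then show ?thesis
    unfolding monom_span_def mem_Collect_eq by (rule exI[of _ "\<lambda>m. if m = n then q else 0"])
qed

lemma ratpoly_imp_monom_span:
  assumes I: "finite I" and "P \<in> ratpoly I"
  shows "\<exists>D. P \<in> monom_span (expo_box I D)"
  using assms(2)
proof (induction rule: ratpoly.induct)
  case (const c)
  have "(\<lambda>z. of_rat c * monom_fun (\<lambda>i. 0) z) \<in> monom_span (expo_box I 0)"
    by (intro monom_fun_in_span finite_expo_box I) (auto simp: expo_box_def)
  then show ?case by (auto simp: monom_fun_def)
next
  case (var i)
  have "(\<lambda>z. of_rat 1 * monom_fun (\<lambda>j. if j = i then 1 else 0) z) \<in> monom_span (expo_box I 1)"
    using var by (intro monom_fun_in_span finite_expo_box I) (auto simp: expo_box_def)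
  moreover have "monom_fun (\<lambda>j. if j = i then 1 else 0) = (\<lambda>z. z i)"
  proof
    fix z :: "'a \<Rightarrow> real"
    have "{j. (if j = i then 1 else 0 :: nat) \<noteq> 0} = {i}" by auto
    then show "monom_fun (\<lambda>j. if j = i then 1 else 0) z = z i" by (simp add: monom_fun_def)
  qed
  ultimately show ?case by auto
next
  case (add P Q)
  then obtain D D' where "P \<in> monom_span (expo_box I D)" "Q \<in> monom_span (expo_box I D')" by auto
  then have "P \<in> monom_span (expo_box I (max D D'))" "Q \<in> monom_span (expo_box I (max D D'))"
    using monom_span_mono[OF finite_expo_box[OF I] expo_box_mono, of D "max D D'"]
      monom_span_mono[OF finite_expo_box[OF I] expo_box_mono, of D' "max D D'"] by auto
  then show ?case using monom_span_add by blast
next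
  case (mult P Q)
  then show ?case using monom_span_mult[OF I] by blast
qed

lemma monom_span_power:
  assumes I: "finite I" and P: "P \<in> monom_span (expo_box I D)"
  shows "(\<lambda>z. P z ^ n) \<in> monom_span (expo_box I (n * D))"
proof (induction n)
  case 0
  have "(\<lambda>z. of_rat 1 * monom_fun (\<lambda>i. 0) z) \<in> monom_span (expo_box I 0)"
    by (intro monom_fun_in_span finite_expo_box I) (auto simp: expo_box_def)
  then show ?case by (auto simp: monom_fun_def)
next
  case (Suc n)
  then show ?case using monom_span_mult[OF I P Suc] by simp
qed

lemma monom_span_prod:
  assumes I: "finite I" and "finite S" "\<And>b. b \<in> S \<Longrightarrow> P b \<in> monom_span (expo_box I D)"
  shows "(\<lambda>z. \<Prod>b\<in>S. P b z) \<in> monom_span (expo_box I (card S * D))"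
  using assms(2,3)
proof (induction S rule: finite_induct)
  case empty
  have "(\<lambda>z. of_rat 1 * monom_fun (\<lambda>i. 0) z) \<in> monom_span (expo_box I 0)"
    by (intro monom_fun_in_span finite_expo_box I) (auto simp: expo_box_def)
  then show ?case by (auto simp: monom_fun_def)
next
  case (insert b S)
  then show ?case using monom_span_mult[OF I, of "P b" D] by simp
qed

section \<open>Generic points and their density\<close>

definition rat_generic :: "'i set \<Rightarrow> ('i \<Rightarrow> real) \<Rightarrow> bool" where
  "rat_generic I x \<longleftrightarrow> (\<forall>P\<in>ratpoly I. P x = 0 \<longrightarrow> (\<forall>z. P z = 0))"

text \<open>Passing from coefficients to functions loses nothing: a coefficient family whose
  function vanishes everywhere is zero by \<open>monom_fun_linear_independent\<close>.\<close>

lemma alg_indep_Q_iff_rat_generic: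
  assumes I: "finite I"
  shows "alg_indep_Q x I \<longleftrightarrow> rat_generic I x"
proof
  assume x: "alg_indep_Q x I"
  show "rat_generic I x"
    unfolding rat_generic_def
  proof (intro ballI impI allI)
    fix P z assume P: "P \<in> ratpoly I" "P x = 0"
    obtain D c where c: "P = (\<lambda>z. \<Sum>m\<in>expo_box I D. of_rat (c m) * monom_fun m z)"
      using ratpoly_imp_monom_span[OF I P(1)] by (auto simp: monom_span_def)
    let ?c = "\<lambda>m. if m \<in> expo_box I D then c m else 0"
    have sub: "{m. ?c m \<noteq> 0} \<subseteq> expo_box I D" by auto
    have fin: "finite {m. ?c m \<noteq> 0}"
      using sub finite_expo_box[OF I] by (rule finite_subset)
    have Pz: "P z = (\<Sum>m\<in>{m. ?c m \<noteq> 0}. of_rat (?c m) * monom_fun m z)" for z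
      unfolding c using sub finite_expo_box[OF I] by (intro sum.mono_neutral_cong_right) auto
    have "\<forall>m. ?c m = 0"
    proof (rule x[unfolded alg_indep_Q_def, THEN spec[of _ ?c], THEN mp], intro conjI allI impI)
      show "(\<Sum>m\<in>{m. ?c m \<noteq> 0}. of_rat (?c m) * (\<Prod>i\<in>{i. m i \<noteq> 0}. x i ^ m i)) = 0"
        using P(2) Pz[of x] by (simp add: monom_fun_def)
      show "finite {m. ?c m \<noteq> 0}" by (rule fin)
    next
      fix m assume "?c m \<noteq> 0"
      then have m: "m \<in> expo_box I D" by (auto split: if_splits)
      then show "finite {i. m i \<noteq> 0}" by (rule finite_support_expo_box[OF I])
      show "{i. m i \<noteq> 0} \<subseteq> I" using m by (auto simp: expo_box_def)
    qed
    then show "P z = 0" by (simp add: Pz)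
  qed
next
  assume x: "rat_generic I x"
  show "alg_indep_Q x I"
    unfolding alg_indep_Q_def
  proof (intro allI impI, elim conjE)
    fix c :: "('a \<Rightarrow> nat) \<Rightarrow> rat" and m
    assume c: "finite {m. c m \<noteq> 0}" "\<forall>m. c m \<noteq> 0 \<longrightarrow> finite {i. m i \<noteq> 0} \<and> {i. m i \<noteq> 0} \<subseteq> I"
      and s: "(\<Sum>m\<in>{m. c m \<noteq> 0}. of_rat (c m) * (\<Prod>i\<in>{i. m i \<noteq> 0}. x i ^ m i)) = 0"
    let ?P = "\<lambda>z. \<Sum>m\<in>{m. c m \<noteq> 0}. of_rat (c m) * monom_fun m z"
    have "?P \<in> ratpoly I"
      using c by (intro ratpoly_sum ratpoly.mult ratpoly.const ratpoly_monom_fun) auto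
    moreover have "?P x = 0" using s by (simp add: monom_fun_def)
    ultimately have "?P z = 0" for z using x by (auto simp: rat_generic_def)
    then have "\<forall>m\<in>{m. c m \<noteq> 0}. (of_rat (c m) :: real) = 0"
      using c by (intro monom_fun_linear_independent) auto
    then show "c m = 0" by auto
  qed
qed

lemma rat_generic_subset: "rat_generic J x \<Longrightarrow> I \<subseteq> J \<Longrightarrow> rat_generic I x"
  unfolding rat_generic_def using ratpoly_mono by blast

text \<open>\<open>L n\<close> collects what at most \<open>n\<close> nested additions and
  multiplications produce. Countability leaves only countably many conditions on a new generic
  coordinate.\<close>

lemma countable_ratpoly:
  assumes "countable I" shows "countable (ratpoly I)"
proof -
  define L where "L = rec_nat (range (\<lambda>c z. of_rat c) \<union> (\<lambda>i z. z i) ` I)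
    (\<lambda>_ X. X \<union> (\<lambda>(P, Q) z. P z + Q z) ` (X \<times> X) \<union> (\<lambda>(P, Q) z. P z * Q z) ` (X \<times> X) :: (('a \<Rightarrow> real) \<Rightarrow> real) set)"
  have L0: "L 0 = range (\<lambda>c z. of_rat c) \<union> (\<lambda>i z. z i) ` I"
    and LS: "L (Suc n) = L n \<union> (\<lambda>(P, Q) z. P z + Q z) ` (L n \<times> L n) \<union> (\<lambda>(P, Q) z. P z * Q z) ` (L n \<times> L n)" for n
    by (simp_all add: L_def)
  have mono: "L m \<subseteq> L n" if "m \<le> n" for m n
    using that by (rule lift_Suc_mono_le[rotated]) (auto simp: LS)
  have cnt: "countable (L n)" for n
    by (induction n) (auto simp: L0 LS assms)
  have "P \<in> (\<Union>n. L n)" if "P \<in> ratpoly I" for P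
    using that
  proof (induction rule: ratpoly.induct)
    case (const c)
    show ?case by (rule UN_I[of 0]) (auto simp: L0)
  next
    case (var i)
    then show ?case by (intro UN_I[of 0]) (auto simp: L0)
  next
    case (add P Q)
    then obtain m n where "P \<in> L m" "Q \<in> L n" by auto
    then have "P \<in> L (max m n)" "Q \<in> L (max m n)"
      using mono[of m "max m n"] mono[of n "max m n"] by auto
    then show ?case by (intro UN_I[of "Suc (max m n)"]) (auto simp: LS image_iff)
  next
    case (mult P Q)
    then obtain m n where "P \<in> L m" "Q \<in> L n" by auto
    then have "P \<in> L (max m n)" "Q \<in> L (max m n)"
      using mono[of m "max m n"] mono[of n "max m n"] by auto
    then show ?case by (intro UN_I[of "Suc (max m n)"]) (auto simp: LS image_iff)
  qed
  then show ?thesis using cnt by (intro countable_subset[of "ratpoly I" "\<Union>n. L n"]) auto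
qed

lemma ratpoly_univariate:
  assumes "P \<in> ratpoly I"
  shows "\<exists>q. \<forall>t. P (x(j := t)) = poly q t"
  using assms
proof (induction rule: ratpoly.induct)
  case (const c)
  show ?case by (rule exI[of _ "[:of_rat c:]"]) simp
next
  case (var i)
  show ?case by (rule exI[of _ "if i = j then [:0, 1:] else [:x i:]"]) simp
next
  case (add P Q)
  then obtain p q where "\<forall>t. P (x(j := t)) = poly p t" "\<forall>t. Q (x(j := t)) = poly q t" by blast
  then show ?case by (intro exI[of _ "p + q"]) (simp del: fun_upd_apply)
next
  case (mult P Q)
  then obtain p q where "\<forall>t. P (x(j := t)) = poly p t" "\<forall>t. Q (x(j := t)) = poly q t" by blast
  then show ?case by (intro exI[of _ "p * q"]) (simp del: fun_upd_apply)
qed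

text \<open>Each nonzero polynomial forbids only finitely many values of the new coordinate, so
  countably many of them cannot exhaust an interval.\<close>

lemma rat_generic_extend1:
  assumes I: "finite I" and j: "j \<notin> I" and x: "rat_generic I x" and ab: "a < b"
  shows "\<exists>t. a < t \<and> t < b \<and> rat_generic (insert j I) (x(j := t))"
proof -
  define NZ where "NZ = {P \<in> ratpoly (insert j I). \<exists>z. P z \<noteq> 0}"
  have fin: "finite {t. P (x(j := t)) = 0}" if P: "P \<in> NZ" for P
  proof (rule ccontr)
    assume inf: "infinite {t. P (x(j := t)) = 0}"
    have PJ: "P \<in> ratpoly (insert j I)" using P by (auto simp: NZ_def)
    obtain q where q: "\<And>t. P (x(j := t)) = poly q t" using ratpoly_univariate[OF PJ] by metis
    have "q = 0" using poly_roots_finite[of q] inf by (auto simp: q)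
    \<comment> \<open>A rational value of coordinate \<open>j\<close> keeps the coefficients
      rational and leaves a polynomial over \<open>I\<close>. It vanishes at the generic
      \<open>x\<close>, hence everywhere. There are infinitely many rationals, so \<open>P\<close>
      then vanishes on every line in direction \<open>j\<close>.\<close>
    have rat0: "P (z(j := of_rat r)) = 0" for z r
    proof -
      have "(\<lambda>z. P (\<lambda>i. if i = j then of_rat r else z i)) \<in> ratpoly I"
      proof (rule ratpoly_compose[OF PJ, of "\<lambda>i z. if i = j then of_rat r else z i"])
        fix i assume "i \<in> insert j I"
        then show "(\<lambda>z. if i = j then of_rat r else z i) \<in> ratpoly I"
          by (cases "i = j") (auto intro: ratpoly.const ratpoly.var)
      qed
      moreover have "P (\<lambda>i. if i = j then of_rat r else x i) = 0"
        using q[of "of_rat r"] \<open>q = 0\<close> by (simp add: fun_upd_def)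
      ultimately have "P (\<lambda>i. if i = j then of_rat r else z i) = 0"
        using x unfolding rat_generic_def by fast
      then show ?thesis by (simp add: fun_upd_def)
    qed
    have "P z = 0" for z
    proof -
      obtain q' where q': "\<And>t. P (z(j := t)) = poly q' t" using ratpoly_univariate[OF PJ] by metis
      have "q' = 0"
      proof (rule ccontr)
        assume "q' \<noteq> 0"
        then have "finite {t. poly q' t = 0}" by (rule poly_roots_finite)
        moreover have "range (of_rat :: rat \<Rightarrow> real) \<subseteq> {t. poly q' t = 0}"
          using rat0[of z] by (auto simp flip: q')
        ultimately have "finite (range (of_rat :: rat \<Rightarrow> real))" using finite_subset by blast
        then show False using finite_imageD[of of_rat "UNIV :: rat set"] by (auto simp: inj_on_def infinite_UNIV_char_0)
      qed
      then show ?thesis using q'[of "z j"] by simp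
    qed
    then show False using P by (auto simp: NZ_def)
  qed
  have "countable NZ"
    unfolding NZ_def
    by (rule countable_subset[OF _ countable_ratpoly[of "insert j I"]]) (use I in \<open>auto intro: countable_finite\<close>)
  then have "countable (\<Union>P\<in>NZ. {t. P (x(j := t)) = 0})"
    using fin by (intro countable_UN) (auto intro: countable_finite)
  moreover have "uncountable {a<..<b}" using ab by (simp add: uncountable_open_interval)
  ultimately obtain t where "t \<in> {a<..<b}" "t \<notin> (\<Union>P\<in>NZ. {t. P (x(j := t)) = 0})"
    by (meson countable_subset subsetI)
  then show ?thesis
    by (intro exI[of _ t]) (auto simp: rat_generic_def NZ_def)
qed

lemma rat_generic_extend:
  assumes "finite J" "finite I" "I \<inter> J = {}" "rat_generic I x" "\<And>j. j \<in> J \<Longrightarrow> a j < b j"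
  shows "\<exists>y. rat_generic (I \<union> J) y \<and> (\<forall>i. i \<notin> J \<longrightarrow> y i = x i) \<and> (\<forall>j\<in>J. a j < y j \<and> y j < b j)"
  using assms(1,3,5)
proof (induction J rule: finite_induct)
  case empty
  then show ?case using assms(4) by auto
next
  case (insert j J)
  have "I \<inter> J = {}" "\<And>j. j \<in> J \<Longrightarrow> a j < b j" using insert.prems by auto
  then obtain y where y: "rat_generic (I \<union> J) y" "\<forall>i. i \<notin> J \<longrightarrow> y i = x i" "\<forall>j\<in>J. a j < y j \<and> y j < b j"
    using insert.IH by blast
  have "j \<notin> I \<union> J" "finite (I \<union> J)" "a j < b j" using insert assms(2) by auto
  from rat_generic_extend1[OF this(2,1) y(1) this(3)] obtain t where
    t: "a j < t" "t < b j" "rat_generic (insert j (I \<union> J)) (y(j := t))" by blast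
  have "a k < (y(j := t)) k \<and> (y(j := t)) k < b k" if "k \<in> insert j J" for k
    using that t y by (cases "k = j") auto
  then show ?case
    using t(3) y(2) by (intro exI[of _ "y(j := t)"] conjI) (auto simp del: fun_upd_apply simp: fun_upd_other)
qed

lemma rat_generic_empty: "rat_generic {} x"
  unfolding rat_generic_def using ratpoly_cong[of _ "{}"] by (metis empty_iff)

lemma rat_generic_dense:
  assumes "finite I" "\<And>i. i \<in> I \<Longrightarrow> a i < b i"
  shows "\<exists>y. rat_generic I y \<and> (\<forall>i\<in>I. a i < y i \<and> y i < b i)"
  using rat_generic_extend[of I "{}" undefined a b] assms rat_generic_empty by auto

subsection \<open>Algebraic dependence of polynomial functions\<close>

text \<open>Gaussian elimination, one equation at a time. It is needed over the rationals, since the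
  relation built from the solution must have rational coefficients.\<close>

lemma underdetermined_system_nontrivial_solution:
  fixes a :: "'e \<Rightarrow> 'u \<Rightarrow> 'f::field"
  assumes "finite Eq" "finite U" "card Eq < card U"
  shows "\<exists>c. (\<exists>u\<in>U. c u \<noteq> 0) \<and> (\<forall>e\<in>Eq. (\<Sum>u\<in>U. a e u * c u) = 0)"
  using assms
proof (induction Eq arbitrary: U a rule: finite_induct)
  case empty
  then obtain u where "u \<in> U" by fastforce
  then show ?case by (intro exI[of _ "\<lambda>_. 1"]) auto
next
  case (insert e Eq)
  show ?case
  proof (cases "\<forall>u\<in>U. a e u = 0")
    case True
    obtain c where "\<exists>u\<in>U. c u \<noteq> 0" "\<forall>e\<in>Eq. (\<Sum>u\<in>U. a e u * c u) = 0"
      using insert.IH[of U a] insert.prems insert.hyps by auto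
    then show ?thesis using True by (intro exI[of _ c]) auto
  next
    case False
    then obtain v where v: "v \<in> U" "a e v \<noteq> 0" by auto
    let ?U = "U - {v}" and ?a = "\<lambda>e' u. a e' u - a e' v * a e u / a e v"
    have "card Eq < card ?U" using insert v by simp
    then obtain c where c: "\<exists>u\<in>?U. c u \<noteq> 0" "\<forall>e'\<in>Eq. (\<Sum>u\<in>?U. ?a e' u * c u) = 0"
      using insert.IH[of ?U ?a] insert.prems by auto
    let ?s = "\<Sum>u\<in>?U. a e u * c u"
    let ?c = "c(v := - ?s / a e v)"
    have split: "(\<Sum>u\<in>U. a e' u * ?c u) = (\<Sum>u\<in>?U. a e' u * c u) - a e' v * ?s / a e v" for e'
    proof -
      have "(\<Sum>u\<in>U. a e' u * ?c u) = a e' v * ?c v + (\<Sum>u\<in>?U. a e' u * ?c u)"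
        using v insert.prems by (simp add: sum.remove)
      moreover have "(\<Sum>u\<in>?U. a e' u * ?c u) = (\<Sum>u\<in>?U. a e' u * c u)"
        by (intro sum.cong) auto
      ultimately show ?thesis by simp
    qed
    have "(\<Sum>u\<in>U. a e' u * ?c u) = 0" if "e' \<in> Eq" for e'
    proof -
      have "(\<Sum>u\<in>?U. ?a e' u * c u) = (\<Sum>u\<in>?U. a e' u * c u) - a e' v * ?s / a e v"
        by (simp add: sum_subtractf sum_distrib_left sum_divide_distrib left_diff_distrib mult.assoc)
      then show ?thesis using c(2) that split by auto
    qed
    moreover have "(\<Sum>u\<in>U. a e u * ?c u) = 0" using split v by simp
    moreover have "\<exists>u\<in>U. ?c u \<noteq> 0" using c(1) by auto
    ultimately show ?thesis by (intro exI[of _ ?c]) blast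
  qed
qed

text \<open>The members of \<open>B\<close> are both the variables of \<open>Q\<close> and the
  functions substituted for them: \<open>\<lambda>b. b z\<close> is the point whose coordinate at
  \<open>b\<close> is the value of \<open>b\<close> at \<open>z\<close>.\<close>

definition alg_indep_funs :: "(('i \<Rightarrow> real) \<Rightarrow> real) set \<Rightarrow> bool" where
  "alg_indep_funs B \<longleftrightarrow> (\<forall>Q\<in>ratpoly B. (\<forall>z. Q (\<lambda>b. b z) = 0) \<longrightarrow> (\<forall>w. Q w = 0))"

text \<open>The leading coefficient must be nonzero after the substitution, not just as a
  polynomial; otherwise a relation inside a dependent \<open>F\<close> would make every function
  algebraic. Degree 0 is thereby impossible.\<close>

definition alg_over :: "(('i \<Rightarrow> real) \<Rightarrow> real) set \<Rightarrow> (('i \<Rightarrow> real) \<Rightarrow> real) \<Rightarrow> bool" where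
  "alg_over F g \<longleftrightarrow> (\<exists>m a. (\<forall>i\<le>m. a i \<in> ratpoly F) \<and>
     (\<forall>z. (\<Sum>i\<le>m. a i (\<lambda>b. b z) * g z ^ i) = 0) \<and> (\<exists>z. a m (\<lambda>b. b z) \<noteq> 0))"

text \<open>Bound on the transcendence degree by counting. With k functions in n variables, the
  (K+1)^k monomials in \<open>B\<close> with exponents up to K all lie in the span of (N+1)^n
  monomials, where N is linear in K. If k > n, a large K forces a linear relation.\<close>

lemma card_alg_indep_le:
  assumes I: "finite I" and B: "finite B" "B \<subseteq> ratpoly I" and ind: "alg_indep_funs B"
  shows "card B \<le> card I"
proof (rule ccontr)
  assume "\<not> card B \<le> card I"
  define k n where "k = card B" and "n = card I"
  have kn: "n + 1 \<le> k" using \<open>\<not> card B \<le> card I\<close> by (simp add: k_def n_def)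
  obtain Df where Df: "\<And>b. b \<in> B \<Longrightarrow> b \<in> monom_span (expo_box I (Df b))"
    using bchoice[of B "\<lambda>b D. b \<in> monom_span (expo_box I D)"] ratpoly_imp_monom_span[OF I] B(2) by blast
  define D where "D = Max (insert 0 (Df ` B))"
  have D: "b \<in> monom_span (expo_box I D)" if "b \<in> B" for b
    using Df[OF that] monom_span_mono[OF finite_expo_box[OF I] expo_box_mono, of "Df b" D] that B(1)
    by (auto simp: D_def)
  \<comment> \<open>Chosen to absorb the constant factor: (N+1)^n <= (kD+1)^n (K+1)^n = K (K+1)^n <
    (K+1)^(n+1).\<close>
  define K where "K = (k * D + 1) ^ n"
  define N where "N = k * (K * D)"
  have "\<forall>e\<in>expo_box B K. \<exists>a. (\<lambda>z. monom_fun e (\<lambda>b. b z)) = (\<lambda>z. \<Sum>m\<in>expo_box I N. of_rat (a m) * monom_fun m z)"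
  proof
    fix e assume e: "e \<in> expo_box B K"
    have "(\<lambda>z. \<Prod>b\<in>B. b z ^ e b) \<in> monom_span (expo_box I N)"
      unfolding N_def k_def
    proof (rule monom_span_prod[OF I B(1)])
      fix b assume b: "b \<in> B"
      have "e b * D \<le> K * D" using e by (auto simp: expo_box_def)
      then show "(\<lambda>z. b z ^ e b) \<in> monom_span (expo_box I (K * D))"
        using monom_span_power[OF I D[OF b], of "e b"]
          monom_span_mono[OF finite_expo_box[OF I] expo_box_mono] by blast
    qed
    moreover have "(\<lambda>z. monom_fun e (\<lambda>b. b z)) = (\<lambda>z. \<Prod>b\<in>B. b z ^ e b)"
      using e monom_fun_eq_prod[OF B(1), of e] by (auto simp: expo_box_def)
    ultimately show "\<exists>a. (\<lambda>z. monom_fun e (\<lambda>b. b z)) = (\<lambda>z. \<Sum>m\<in>expo_box I N. of_rat (a m) * monom_fun m z)"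
      by (simp add: monom_span_def)
  qed
  from bchoice[OF this] obtain a where a: "\<And>e. e \<in> expo_box B K \<Longrightarrow>
      (\<lambda>z. monom_fun e (\<lambda>b. b z)) = (\<lambda>z. \<Sum>m\<in>expo_box I N. of_rat (a e m) * monom_fun m z)"
    by blast
  have "(N + 1) ^ n \<le> ((k * D + 1) * (K + 1)) ^ n"
    by (rule power_mono) (auto simp: N_def algebra_simps)
  also have "\<dots> = K * (K + 1) ^ n" unfolding power_mult_distrib K_def[symmetric] ..
  also have "\<dots> < (K + 1) ^ (n + 1)" by simp
  also have "\<dots> \<le> (K + 1) ^ k" using kn by (intro power_increasing) auto
  finally have card: "card (expo_box I N) < card (expo_box B K)"
    by (simp add: card_expo_box I B n_def k_def)
  obtain c where c: "\<exists>e\<in>expo_box B K. c e \<noteq> 0"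
      "\<forall>m\<in>expo_box I N. (\<Sum>e\<in>expo_box B K. a e m * c e) = 0"
    using underdetermined_system_nontrivial_solution[OF finite_expo_box[OF I] finite_expo_box[OF B(1)] card,
        of "\<lambda>m e. a e m"] by blast
  define Q where "Q = (\<lambda>w. \<Sum>e\<in>expo_box B K. of_rat (c e) * monom_fun e w)"
  have "Q \<in> ratpoly B"
    unfolding Q_def
    by (intro ratpoly_sum ratpoly.mult ratpoly.const ratpoly_monom_fun) (auto simp: expo_box_def)
  moreover have "Q (\<lambda>b. b z) = 0" for z
  proof -
    have "Q (\<lambda>b. b z) = (\<Sum>e\<in>expo_box B K. of_rat (c e) * (\<Sum>m\<in>expo_box I N. of_rat (a e m) * monom_fun m z))"
      unfolding Q_def
    proof (intro sum.cong refl)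
      fix e assume "e \<in> expo_box B K"
      then show "of_rat (c e) * monom_fun e (\<lambda>b. b z) = of_rat (c e) * (\<Sum>m\<in>expo_box I N. of_rat (a e m) * monom_fun m z)"
        using fun_cong[OF a, of e z] by simp
    qed
    also have "\<dots> = (\<Sum>e\<in>expo_box B K. \<Sum>m\<in>expo_box I N. of_rat (a e m * c e) * monom_fun m z)"
      by (simp add: sum_distrib_left of_rat_mult mult_ac)
    also have "\<dots> = (\<Sum>m\<in>expo_box I N. \<Sum>e\<in>expo_box B K. of_rat (a e m * c e) * monom_fun m z)"
      by (rule sum.swap)
    also have "\<dots> = (\<Sum>m\<in>expo_box I N. of_rat (\<Sum>e\<in>expo_box B K. a e m * c e) * monom_fun m z)"
      by (simp add: of_rat_sum sum_distrib_right)
    also have "\<dots> = 0" using c(2) by simp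
    finally show ?thesis .
  qed
  ultimately have "Q w = 0" for w using ind by (auto simp: alg_indep_funs_def)
  then have "\<forall>e\<in>expo_box B K. (of_rat (c e) :: real) = 0"
    using finite_expo_box[OF B(1)] finite_support_expo_box[OF B(1)]
    by (intro monom_fun_linear_independent) (auto simp: Q_def)
  then show False using c(1) by simp
qed

lemma alg_over_mono: "F \<subseteq> G \<Longrightarrow> alg_over F g \<Longrightarrow> alg_over G g"
  unfolding alg_over_def using ratpoly_mono by blast

lemma alg_over_member: assumes "g \<in> F" shows "alg_over F g"
  unfolding alg_over_def
proof (intro exI[of _ 1] exI[of _ "\<lambda>i w. if i = 0 then - w g else 1"] conjI allI impI)
  fix i :: nat assume "i \<le> 1"
  show "(\<lambda>w. if i = 0 then - w g else 1) \<in> ratpoly F"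
    using assms by (cases "i = 0") (auto intro: ratpoly_uminus ratpoly.var ratpoly_1)
qed auto

text \<open>The coefficients form an infinite sequence that vanishes beyond \<open>m\<close>, so
  that sums can be padded to a common length and products are Cauchy products.\<close>

lemma ratpoly_insert_expand:
  assumes "Q \<in> ratpoly (insert j J)"
  shows "\<exists>m a. (\<forall>i. a i \<in> ratpoly J) \<and> (\<forall>i>m. \<forall>w. a i w = 0) \<and> (\<forall>w. Q w = (\<Sum>i\<le>m. a i w * w j ^ i))"
  using assms
proof (induction rule: ratpoly.induct)
  case (const c)
  show ?case
  proof (intro exI[of _ 0] exI[of _ "\<lambda>i w. if i = 0 then of_rat c else 0"] conjI allI impI)
    fix i :: nat show "(\<lambda>w. if i = 0 then of_rat c else 0) \<in> ratpoly J"
      by (cases "i = 0") (auto intro: ratpoly.const ratpoly_0)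
  qed auto
next
  case (var i)
  show ?case
  proof (cases "i = j")
    case True
    show ?thesis
    proof (intro exI[of _ 1] exI[of _ "\<lambda>i w. if i = 1 then 1 else 0"] conjI allI impI)
      fix i :: nat show "(\<lambda>w. if i = 1 then 1 else 0) \<in> ratpoly J"
        by (cases "i = 1") (auto intro: ratpoly_1 ratpoly_0)
    qed (auto simp: True)
  next
    case False
    show ?thesis
    proof (intro exI[of _ 0] exI[of _ "\<lambda>k w. if k = 0 then w i else 0"] conjI allI impI)
      fix k :: nat show "(\<lambda>w. if k = 0 then w i else 0) \<in> ratpoly J"
        using False var by (cases "k = 0") (auto intro: ratpoly.var ratpoly_0)
    qed auto
  qed
next
  case (add P Q)
   from add.IH(1) obtain m a where a: "\<And>i. a i \<in> ratpoly J" "\<And>i w. i > m \<Longrightarrow> a i w = 0" "\<And>w. P w = (\<Sum>i\<le>m. a i w * w j ^ i)"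
    by blast
  from add.IH(2) obtain m' b where b: "\<And>i. b i \<in> ratpoly J" "\<And>i w. i > m' \<Longrightarrow> b i w = 0" "\<And>w. Q w = (\<Sum>i\<le>m'. b i w * w j ^ i)"
    by blast
  have 1: "P w = (\<Sum>i\<le>max m m'. a i w * w j ^ i)" for w
    unfolding a(3) by (rule sum.mono_neutral_left) (auto simp: a(2))
  have 2: "Q w = (\<Sum>i\<le>max m m'. b i w * w j ^ i)" for w
    unfolding b(3) by (rule sum.mono_neutral_left) (auto simp: b(2))
  show ?case
    by (intro exI[of _ "max m m'"] exI[of _ "\<lambda>i w. a i w + b i w"] conjI allI impI)
      (auto intro: ratpoly.add a b simp: a(2) b(2) 1 2 sum.distrib distrib_right)
next
  case (mult P Q)
   from mult.IH(1) obtain m a where a: "\<And>i. a i \<in> ratpoly J" "\<And>i w. i > m \<Longrightarrow> a i w = 0" "\<And>w. P w = (\<Sum>i\<le>m. a i w * w j ^ i)"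
    by blast
  from mult.IH(2) obtain m' b where b: "\<And>i. b i \<in> ratpoly J" "\<And>i w. i > m' \<Longrightarrow> b i w = 0" "\<And>w. Q w = (\<Sum>i\<le>m'. b i w * w j ^ i)"
    by blast
  show ?case
  proof (intro exI[of _ "m + m'"] exI[of _ "\<lambda>r w. \<Sum>k\<le>r. a k w * b (r - k) w"] conjI allI impI)
    fix r show "(\<lambda>w. \<Sum>k\<le>r. a k w * b (r - k) w) \<in> ratpoly J"
      by (intro ratpoly_sum ratpoly.mult a b)
  next
    fix r w assume r: "m + m' < r"
    show "(\<Sum>k\<le>r. a k w * b (r - k) w) = 0"
    proof (rule sum.neutral, rule ballI)
      fix k assume "k \<in> {..r}"
      show "a k w * b (r - k) w = 0"
        using r a(2)[of k w] b(2)[of "r - k" w] by (cases "k > m") auto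
    qed
  next
    fix w
    show "P w * Q w = (\<Sum>r\<le>m + m'. (\<Sum>k\<le>r. a k w * b (r - k) w) * w j ^ r)"
      unfolding a(3) b(3) by (rule polynomial_product) (auto simp: a(2) b(2))
  qed
qed

lemma alg_over_if_dependent:
  assumes B: "alg_indep_funs B" and dep: "\<not> alg_indep_funs (insert h B)"
  shows "alg_over B h"
proof -
  obtain Q w0 where Q: "Q \<in> ratpoly (insert h B)" "\<And>z. Q (\<lambda>b. b z) = 0" "Q w0 \<noteq> 0"
    using dep by (auto simp: alg_indep_funs_def)
  obtain m a where a: "\<And>i. a i \<in> ratpoly B" "\<And>w. Q w = (\<Sum>i\<le>m. a i w * w h ^ i)"
    using ratpoly_insert_expand[OF Q(1)] by blast
  \<comment> \<open>Top coefficients that vanish identically are cut off. The last one left is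
    nonzero as a polynomial and, \<open>B\<close> being independent, stays nonzero after the
    substitution.\<close>
  define S where "S = {i. i \<le> m \<and> (\<exists>w. a i w \<noteq> 0)}"
  have "S \<noteq> {}"
  proof
    assume "S = {}"
    then have "Q w0 = 0" unfolding a(2) by (intro sum.neutral) (auto simp: S_def)
    then show False using Q(3) by simp
  qed
  moreover have "finite S" by (rule finite_subset[of _ "{..m}"]) (auto simp: S_def)
  ultimately have M: "Max S \<in> S" "\<And>i. i \<in> S \<Longrightarrow> i \<le> Max S" by auto
  have "(\<Sum>i\<le>Max S. a i w * w h ^ i) = Q w" for w
    unfolding a(2) using M(1)
  proof (intro sum.mono_neutral_left ballI)
    fix i assume "i \<in> {..m} - {..Max S}"
    then have "i \<notin> S" "i \<le> m" using M(2)[of i] by auto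
    then show "a i w * w h ^ i = 0" by (auto simp: S_def)
  qed (auto simp: S_def)
  from this[of "\<lambda>b. b z" for z] have "(\<Sum>i\<le>Max S. a i (\<lambda>b. b z) * h z ^ i) = 0" for z
    using Q(2)[of z] by simp
  moreover have "\<exists>z. a (Max S) (\<lambda>b. b z) \<noteq> 0"
  proof (rule ccontr)
    assume "\<not> ?thesis"
    then have "\<forall>w. a (Max S) w = 0"
      using B a(1)[of "Max S"] unfolding alg_indep_funs_def by auto
    then show False using M(1) by (simp add: S_def)
  qed
  ultimately show ?thesis unfolding alg_over_def using a(1) by blast
qed

lemma alg_indep_funs_empty: "alg_indep_funs {}"
  unfolding alg_indep_funs_def using ratpoly_cong[of _ "{}"] by (metis empty_iff)

text \<open>A transcendence basis of \<open>F\<close> that extends \<open>B0\<close>: by maximality,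
  adding any further member creates a dependence, which exhibits that member as algebraic.\<close>

lemma maximal_alg_indep_funs:
  assumes F: "finite F" and "B0 \<subseteq> F" "alg_indep_funs B0"
  obtains B where "B0 \<subseteq> B" "B \<subseteq> F" "alg_indep_funs B" "\<And>h. h \<in> F \<Longrightarrow> alg_over B h"
proof -
  define S where "S = {B. B0 \<subseteq> B \<and> B \<subseteq> F \<and> alg_indep_funs B}"
  have "finite S" by (rule finite_subset[of _ "Pow F"]) (auto simp: F S_def)
  moreover have "B0 \<in> S" using assms by (auto simp: S_def)
  ultimately have "\<exists>B\<in>S. B0 \<subseteq> B \<and> (\<forall>C\<in>S. B \<subseteq> C \<longrightarrow> B = C)" by (rule finite_has_maximal2)
  then obtain B where "B \<in> S" and max: "\<And>C. C \<in> S \<Longrightarrow> B \<subseteq> C \<Longrightarrow> B = C" by auto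
  then have B: "B0 \<subseteq> B" "B \<subseteq> F" "alg_indep_funs B" by (auto simp: S_def)
  have "alg_over B h" if "h \<in> F" for h
  proof (cases "h \<in> B")
    case False
    then have "insert h B \<notin> S" using max[of "insert h B"] by auto
    then show ?thesis using B that by (intro alg_over_if_dependent) (auto simp: S_def)
  qed (rule alg_over_member)
  then show ?thesis using that B by auto
qed

text \<open>Only the coordinates in \<open>I\<close> have to be close; the others remain free,
  whereas a neighbourhood in the whole function space could restrict them too.\<close>

definition near :: "'i set \<Rightarrow> ('i \<Rightarrow> real) \<Rightarrow> ('i \<Rightarrow> real) filter" where
  "near I x = (INF e\<in>{0<..}. principal {z. \<forall>i\<in>I. \<bar>z i - x i\<bar> < e})"

lemma eventually_near:
  "eventually P (near I x) \<longleftrightarrow> (\<exists>e>0. \<forall>z. (\<forall>i\<in>I. \<bar>z i - x i\<bar> < e) \<longrightarrow> P z)"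
  unfolding near_def
proof (subst eventually_INF_base)
  fix a b :: real assume ab: "a \<in> {0<..}" "b \<in> {0<..}"
  show "\<exists>c\<in>{0<..}. principal {z. \<forall>i\<in>I. \<bar>z i - x i\<bar> < c}
      \<le> inf (principal {z. \<forall>i\<in>I. \<bar>z i - x i\<bar> < a}) (principal {z. \<forall>i\<in>I. \<bar>z i - x i\<bar> < b})"
    by (rule bexI[of _ "min a b"]) (use ab in auto)
qed (auto simp: eventually_principal)

lemma tendsto_near_coord: "i \<in> I \<Longrightarrow> ((\<lambda>z. z i) \<longlongrightarrow> x i) (near I x)"
  unfolding tendsto_iff eventually_near dist_real_def by blast

lemma tendsto_near_ratpoly: "P \<in> ratpoly I \<Longrightarrow> (P \<longlongrightarrow> P x) (near I x)"
  by (rule tendsto_ratpoly[of P I "\<lambda>z. z" x]) (auto intro: tendsto_near_coord)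

lemma polyfun_Rolle:
  fixes a :: "nat \<Rightarrow> real"
  assumes "s < t" "(\<Sum>i\<le>m. a i * s ^ i) = 0" "(\<Sum>i\<le>m. a i * t ^ i) = 0"
  shows "\<exists>y. s < y \<and> y < t \<and> (\<Sum>i\<le>m. of_nat i * a i * y ^ (i - 1)) = 0"
proof -
  let ?p = "\<lambda>t. \<Sum>i\<le>m. a i * t ^ i" and ?p' = "\<lambda>y. \<Sum>i\<le>m. of_nat i * a i * y ^ (i - 1)"
  have d: "DERIV ?p y :> ?p' y" for y
    by (auto intro!: derivative_eq_intros sum.cong simp: mult_ac)
  have "\<exists>y>s. y < t \<and> ?p t - ?p s = (t - s) * ?p' y"
    by (rule MVT2[OF assms(1)]) (rule d)
  then obtain y where "s < y" "y < t" "?p t - ?p s = (t - s) * ?p' y" by auto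
  then show ?thesis using assms by (intro exI[of _ y]) auto
qed

text \<open>A relation of minimal degree is separable at a generic point, so it pins down a locally
  unique root.\<close>

lemma alg_over_locally_determined:
  assumes x: "rat_generic I x" and B: "B \<subseteq> ratpoly I" and h: "h \<in> ratpoly I" and alg: "alg_over B h"
  shows "\<exists>e>0. \<forall>z z'. (\<forall>i\<in>I. \<bar>z i - x i\<bar> < e) \<longrightarrow> (\<forall>i\<in>I. \<bar>z' i - x i\<bar> < e) \<longrightarrow>
    (\<forall>b\<in>B. b z = b z') \<longrightarrow> h z = h z'"
proof -
  define R where "R = (\<lambda>m. \<exists>a. (\<forall>i\<le>m. a i \<in> ratpoly B) \<and>
     (\<forall>z. (\<Sum>i\<le>m. a i (\<lambda>b. b z) * h z ^ i) = 0) \<and> (\<exists>z. a m (\<lambda>b. b z) \<noteq> 0))"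
  define m where "m = (LEAST m. R m)"
  have "\<exists>m. R m" using alg unfolding alg_over_def R_def .
  then have "R m" unfolding m_def by (rule LeastI_ex)
  then obtain a where a': "(\<forall>i\<le>m. a i \<in> ratpoly B) \<and>
     (\<forall>z. (\<Sum>i\<le>m. a i (\<lambda>b. b z) * h z ^ i) = 0) \<and> (\<exists>z. a m (\<lambda>b. b z) \<noteq> 0)"
    unfolding R_def ..
  have a: "\<And>i. i \<le> m \<Longrightarrow> a i \<in> ratpoly B"
    "\<And>z. (\<Sum>i\<le>m. a i (\<lambda>b. b z) * h z ^ i) = 0" "\<exists>z. a m (\<lambda>b. b z) \<noteq> 0"
    using a' by auto
  have least: "m \<le> k" if "R k" for k unfolding m_def using that by (rule Least_le)
  have m0: "m \<noteq> 0"
  proof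
    assume "m = 0"
    then show False using a(2,3) by simp
  qed
  \<comment> \<open>The formal derivative of the relation in its unknown. If it vanished identically
    along \<open>h\<close>, an index shift would give a relation of degree m-1 whose leading
    coefficient is m times the old one, against minimality.\<close>
  define G where "G = (\<lambda>z \<xi>. \<Sum>i\<le>m. of_nat i * a i (\<lambda>b. b z) * \<xi> ^ (i - 1))"
  have aI: "(\<lambda>z. a i (\<lambda>b. b z)) \<in> ratpoly I" if "i \<le> m" for i
    using ratpoly_compose[OF a(1)[OF that], of "\<lambda>b. b"] B by auto
  have "(\<lambda>z. G z (h z)) \<in> ratpoly I"
    unfolding G_def by (intro ratpoly_sum ratpoly.mult ratpoly_of_nat ratpoly_power h aI) auto
  moreover have "\<exists>z. G z (h z) \<noteq> 0"
  proof (rule ccontr)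
    assume "\<not> ?thesis"
    then have G0: "G z (h z) = 0" for z by auto
    have "R (m - 1)"
      unfolding R_def
    proof (intro exI[of _ "\<lambda>i w. of_nat (Suc i) * a (Suc i) w"] conjI allI impI)
      fix i assume "i \<le> m - 1"
      then have "Suc i \<le> m" using m0 by auto
      then show "(\<lambda>w. of_nat (Suc i) * a (Suc i) w) \<in> ratpoly B"
        by (intro ratpoly.mult ratpoly_of_nat a)
    next
      fix z
      have "{..m} = insert 0 (Suc ` {..m - 1})"
        using m0 atMost_Suc_eq_insert_0[of "m - 1"] by simp
      then have "G z (h z) = (\<Sum>i\<in>Suc ` {..m - 1}. of_nat i * a i (\<lambda>b. b z) * h z ^ (i - 1))"
        by (simp add: G_def)
      also have "\<dots> = (\<Sum>i\<le>m - 1. of_nat (Suc i) * a (Suc i) (\<lambda>b. b z) * h z ^ i)"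
        by (subst sum.reindex) auto
      finally show "(\<Sum>i\<le>m - 1. of_nat (Suc i) * a (Suc i) (\<lambda>b. b z) * h z ^ i) = 0"
        using G0 by simp
    qed (use a(3) m0 in auto)
    then show False using least[of "m - 1"] m0 by auto
  qed
  ultimately have Gx: "G x (h x) \<noteq> 0" using x unfolding rat_generic_def by auto
  have "((\<lambda>p. G (fst p) (snd p)) \<longlongrightarrow> G x (h x)) (near I x \<times>\<^sub>F nhds (h x))"
  proof -
    have 1: "((\<lambda>p. a i (\<lambda>b. b (fst p))) \<longlongrightarrow> a i (\<lambda>b. b x)) (near I x \<times>\<^sub>F nhds (h x))" if "i \<le> m" for i
      by (rule filterlim_compose[OF tendsto_near_ratpoly[OF aI[OF that], of x] filterlim_fst])
    have 2: "(snd \<longlongrightarrow> h x) (near I x \<times>\<^sub>F nhds (h x))" by (rule filterlim_snd)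
    show ?thesis unfolding G_def by (intro tendsto_intros 1 2) auto
  qed
  then have "\<forall>\<^sub>F p in near I x \<times>\<^sub>F nhds (h x). G (fst p) (snd p) \<noteq> 0"
    using Gx by (intro tendsto_imp_eventually_ne)
  then obtain P1 P2 where P: "eventually P1 (near I x)" "eventually P2 (nhds (h x))"
    "\<And>z \<xi>. P1 z \<Longrightarrow> P2 \<xi> \<Longrightarrow> G z \<xi> \<noteq> 0"
    unfolding eventually_prod_filter by auto
  obtain d where d: "d > 0" "\<And>\<xi>. dist \<xi> (h x) < d \<Longrightarrow> P2 \<xi>"
    using P(2) unfolding eventually_nhds_metric by auto
  have "\<forall>\<^sub>F z in near I x. dist (h z) (h x) < d"
    using tendsto_near_ratpoly[OF h, of x] d(1) by (auto simp: tendsto_iff)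
  then have "\<forall>\<^sub>F z in near I x. P1 z \<and> dist (h z) (h x) < d"
    using P(1) by (rule eventually_conj[rotated])
  then obtain e where e: "e > 0" "\<And>z. (\<forall>i\<in>I. \<bar>z i - x i\<bar> < e) \<Longrightarrow> P1 z \<and> dist (h z) (h x) < d"
    unfolding eventually_near by auto
  \<comment> \<open>Points that agree on \<open>B\<close> have the same relation, and two different
    roots of it close to \<open>h x\<close> would enclose a zero of \<open>G\<close>.\<close>
  have contra: False if z: "\<forall>i\<in>I. \<bar>z i - x i\<bar> < e" "\<forall>i\<in>I. \<bar>z' i - x i\<bar> < e" "\<forall>b\<in>B. b z = b z'" "h z < h z'" for z z'
  proof -
    have "a i (\<lambda>b. b z') = a i (\<lambda>b. b z)" if "i \<le> m" for i
      using z(3) by (intro ratpoly_cong[OF a(1)[OF that]]) auto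
    then have "(\<Sum>i\<le>m. a i (\<lambda>b. b z) * h z' ^ i) = 0"
      using a(2)[of z'] by simp
    from polyfun_Rolle[OF z(4) a(2) this] obtain \<xi> where "h z < \<xi>" "\<xi> < h z'" "G z \<xi> = 0"
      unfolding G_def by auto
    moreover have "P2 \<xi>"
      using e(2)[OF z(1)] e(2)[OF z(2)] calculation by (intro d(2)) (auto simp: dist_real_def)
    ultimately show False using P(3)[of z \<xi>] e(2)[OF z(1)] by auto
  qed
  show ?thesis
  proof (intro exI[of _ e] conjI allI impI)
    fix z z' assume z: "\<forall>i\<in>I. \<bar>z i - x i\<bar> < e" "\<forall>i\<in>I. \<bar>z' i - x i\<bar> < e" "\<forall>b\<in>B. b z = b z'"
    have "\<forall>b\<in>B. b z' = b z"
    proof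
      fix b assume "b \<in> B"
      then show "b z' = b z" using bspec[OF z(3), of b] by simp
    qed
    then show "h z = h z'"
      using contra[OF z] contra[OF z(2,1)] by (cases "h z" "h z'" rule: linorder_cases) auto
  qed (rule e(1))
qed


section \<open>Small motions from invariance of domain\<close>

lemma ex_common_radius:
  assumes "finite S" "\<And>s. s \<in> S \<Longrightarrow> \<exists>e>0. P s (e::real)"
    and "\<And>s e e'. P s e \<Longrightarrow> e' \<le> e \<Longrightarrow> P s e'"
  shows "\<exists>e>0. \<forall>s\<in>S. P s e"
  using assms(1,2)
proof (induction S rule: finite_induct)
  case empty
  then show ?case by (auto intro: exI[of _ 1])
next
  case (insert s S)
  have "\<exists>e>0. \<forall>s\<in>S. P s e" using insert.prems by (intro insert.IH) auto
  then obtain e where e: "e > 0" "\<forall>s\<in>S. P s e" by auto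
  obtain e' where e': "e' > 0" "P s e'" using insert.prems[of s] by auto
  have "P t (min e e')" if "t \<in> insert s S" for t
    using that assms(3)[of t e "min e e'"] assms(3)[of t e' "min e e'"] e e' by auto
  then show ?case using e e' by (intro exI[of _ "min e e'"]) auto
qed

lemma continuous_map_ratpoly:
  assumes "P \<in> ratpoly I" "\<And>i. i \<in> I \<Longrightarrow> continuous_map X euclideanreal (\<lambda>y. g y i)"
  shows "continuous_map X euclideanreal (\<lambda>y. P (g y))"
  using assms
  by (induction rule: ratpoly.induct) (auto intro: continuous_map_add continuous_map_real_mult)

lemma continuous_map_Euclidean_space_coord:
  "continuous_map (Euclidean_space n) euclideanreal (\<lambda>y. y k)"
  unfolding Euclidean_space_def
  by (intro continuous_map_from_subtopology continuous_map_product_projection) auto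

lemma openin_Euclidean_space_box:
  "openin (Euclidean_space n) {y \<in> topspace (Euclidean_space n). \<forall>k<n. \<bar>y k - x k\<bar> < e}"
proof -
  have "openin (Euclidean_space n) {y \<in> topspace (Euclidean_space n). \<forall>k\<in>S. \<bar>y k - x k\<bar> < e}"
    if "finite S" for S
    using that
  proof (induction S rule: finite_induct)
    case (insert k S)
    have "openin (Euclidean_space n) {y \<in> topspace (Euclidean_space n). y k \<in> ball (x k) e}"
      by (rule openin_continuous_map_preimage[OF continuous_map_Euclidean_space_coord]) auto
    moreover have "{y \<in> topspace (Euclidean_space n). \<forall>k\<in>insert k S. \<bar>y k - x k\<bar> < e}
      = {y \<in> topspace (Euclidean_space n). y k \<in> ball (x k) e} \<inter> {y \<in> topspace (Euclidean_space n). \<forall>k\<in>S. \<bar>y k - x k\<bar> < e}"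
      by (auto simp: dist_real_def abs_minus_commute)
    ultimately show ?case using insert.IH by auto
  qed auto
  from this[of "{..<n}"] show ?thesis by (simp add: Ball_def)
qed

text \<open>Complete the independent system made of a basis of F and g by coordinates. At a generic
  point all coordinates are locally determined by the resulting map, which is therefore open by
  invariance of domain; so g can be varied independently.\<close>

lemma motion_if_not_alg_over:
  assumes I: "finite I" and x: "rat_generic I x" and F: "finite F" "F \<subseteq> ratpoly I"
    and g: "g \<in> ratpoly I" and nalg: "\<not> alg_over F g" and e: "e > 0"
  shows "\<exists>z. (\<forall>i\<in>I. \<bar>z i - x i\<bar> < e) \<and> (\<forall>f\<in>F. f z = f x) \<and> g z \<noteq> g x"
proof -
  obtain B where B: "B \<subseteq> F" "alg_indep_funs B" "\<And>h. h \<in> F \<Longrightarrow> alg_over B h"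
    using maximal_alg_indep_funs[OF F(1) _ alg_indep_funs_empty] by auto
  have nB: "\<not> alg_over B g" using nalg alg_over_mono[OF B(1)] by auto
  then have gB: "g \<notin> B" using alg_over_member by auto
  have indg: "alg_indep_funs (insert g B)" using alg_over_if_dependent[OF B(2)] nB by auto
  define X where "X = insert g B \<union> (\<lambda>i z. z i) ` I"
  have finX: "finite X" using finite_subset[OF B(1) F(1)] I by (auto simp: X_def)
  obtain B2 where B2: "insert g B \<subseteq> B2" "B2 \<subseteq> X" "alg_indep_funs B2" "\<And>h. h \<in> X \<Longrightarrow> alg_over B2 h"
    using maximal_alg_indep_funs[OF finX _ indg] by (auto simp: X_def)
  have XI: "X \<subseteq> ratpoly I" using B(1) F(2) g by (auto simp: X_def intro: ratpoly.var)
  then have B2I: "B2 \<subseteq> ratpoly I" using B2(2) by auto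
  have finB2: "finite B2" using finite_subset[OF B2(2) finX] .
  define n k where "n = card I" and "k = card B2"
  \<comment> \<open>Invariance of domain needs a target of dimension at most that of the
    source.\<close>
  have kn: "k \<le> n" unfolding k_def n_def by (rule card_alg_indep_le[OF I finB2 B2I B2(3)])
  define det where "det = (\<lambda>C h e. \<forall>z z'. (\<forall>i\<in>I. \<bar>z i - x i\<bar> < e) \<longrightarrow> (\<forall>i\<in>I. \<bar>z' i - x i\<bar> < e) \<longrightarrow>
    (\<forall>b\<in>C. b z = (b z' :: real)) \<longrightarrow> h z = (h z' :: real))"
  have det_mono: "det C h e'" if "det C h e" "e' \<le> e" for C h e e'
    unfolding det_def
  proof (intro allI impI)
    fix z z' assume z: "\<forall>i\<in>I. \<bar>z i - x i\<bar> < e'" "\<forall>i\<in>I. \<bar>z' i - x i\<bar> < e'" "\<forall>b\<in>C. b z = b z'"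
    show "h z = h z'"
    proof (rule that(1)[unfolded det_def, rule_format])
      fix i assume "i \<in> I"
      then show "\<bar>z i - x i\<bar> < e" "\<bar>z' i - x i\<bar> < e"
        using bspec[OF z(1), of i] bspec[OF z(2), of i] that(2) by auto
    qed (use bspec[OF z(3)] in simp)
  qed
  \<comment> \<open>Two kinds of determinacy are used: near \<open>x\<close> the values on
    \<open>B\<close> fix those on \<open>F\<close>, so that it suffices to hold \<open>B\<close>;
    the values on \<open>B2\<close> fix all coordinates, which gives injectivity.\<close>
  have "\<exists>e>0. \<forall>h\<in>F. det B h e"
  proof (rule ex_common_radius[OF F(1) _ det_mono])
    fix h assume "h \<in> F"
    then show "\<exists>e>0. det B h e"
      unfolding det_def using B F(2) by (intro alg_over_locally_determined x) auto
  qed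
  then obtain e1 where e1: "e1 > 0" "\<And>h. h \<in> F \<Longrightarrow> det B h e1" by auto
  have "\<exists>e>0. \<forall>h\<in>X. det B2 h e"
  proof (rule ex_common_radius[OF finX _ det_mono])
    fix h assume "h \<in> X"
    then show "\<exists>e>0. det B2 h e"
      unfolding det_def using B2 B2I XI by (intro alg_over_locally_determined x) auto
  qed
  then obtain e2 where e2: "e2 > 0" "\<And>h. h \<in> X \<Longrightarrow> det B2 h e2" by auto
  define d where "d = min e (min e1 e2)"
  have d: "d > 0" "d \<le> e" "d \<le> e1" "d \<le> e2" using e e1(1) e2(1) by (auto simp: d_def)
  \<comment> \<open>Points of \<open>Euclidean_space\<close> are indexed by natural numbers, so
    \<open>I\<close> and \<open>B2\<close> are numbered.\<close>
  obtain h where h: "bij_betw h {..<n} I"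
    using ex_bij_betw_nat_finite[OF I] by (auto simp: n_def lessThan_atLeast0)
  obtain \<beta> where \<beta>: "bij_betw \<beta> {..<k} B2"
    using ex_bij_betw_nat_finite[OF finB2] by (auto simp: k_def lessThan_atLeast0)
  define hi where "hi = inv_into {..<n} h"
  have hi: "hi i < n" "h (hi i) = i" if "i \<in> I" for i
    using bij_betwE[OF bij_betw_inv_into[OF h]] bij_betw_inv_into_right[OF h] that by (auto simp: hi_def)
  have hi': "h j \<in> I" "hi (h j) = j" if "j < n" for j
    using bij_betwE[OF h] bij_betw_inv_into_left[OF h] that by (auto simp: hi_def)
  define zz where "zz = (\<lambda>y i. if i \<in> I then y (hi i) else x i)"
  define U where "U = {y \<in> topspace (Euclidean_space n). \<forall>j<n. \<bar>y j - x (h j)\<bar> < d}"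
  define \<Phi> where "\<Phi> = (\<lambda>y j. if j < k then \<beta> j (zz y) else 0)"
  have zzU: "\<bar>zz y i - x i\<bar> < d" if "y \<in> U" "i \<in> I" for y i
  proof -
    have "\<bar>y (hi i) - x (h (hi i))\<bar> < d" using that(1) hi(1)[OF that(2)] unfolding U_def by blast
    then show ?thesis using that(2) by (simp add: zz_def hi(2))
  qed
  have U: "openin (Euclidean_space n) U"
    unfolding U_def by (rule openin_Euclidean_space_box)
  have cont: "continuous_map (subtopology (Euclidean_space n) U) (Euclidean_space k) \<Phi>"
    unfolding \<Phi>_def continuous_map_componentwise_Euclidean_space
  proof (intro allI impI)
    fix j assume "j < k"
    then have "\<beta> j \<in> ratpoly I" using bij_betwE[OF \<beta>] B2I by auto
    then show "continuous_map (subtopology (Euclidean_space n) U) euclideanreal (\<lambda>y. \<beta> j (zz y))"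
    proof (rule continuous_map_ratpoly)
      fix i assume "i \<in> I"
      then show "continuous_map (subtopology (Euclidean_space n) U) euclideanreal (\<lambda>y. zz y i)"
        by (simp add: zz_def continuous_map_from_subtopology continuous_map_Euclidean_space_coord)
    qed
  qed
  have B2eq: "\<forall>b\<in>B2. b z = b z'" if "\<forall>j<k. \<beta> j z = \<beta> j z'" for z z'
    using that bij_betw_imp_surj_on[OF \<beta>] by auto
  have inj: "inj_on \<Phi> U"
  proof (rule inj_onI)
    fix y y' assume y: "y \<in> U" "y' \<in> U" "\<Phi> y = \<Phi> y'"
    have "\<beta> j (zz y) = \<beta> j (zz y')" if "j < k" for j
      using fun_cong[OF y(3), of j] that by (simp add: \<Phi>_def)
    then have eq: "\<forall>b\<in>B2. b (zz y) = b (zz y')" by (intro B2eq) auto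
    show "y = y'"
    proof
      fix j show "y j = y' j"
      proof (cases "j < n")
        case True
        have "(\<lambda>z. z (h j)) \<in> X" using hi'(1)[OF True] by (auto simp: X_def)
        then have "zz y (h j) = zz y' (h j)"
          using e2(2)[of "\<lambda>z. z (h j)", unfolded det_def, rule_format, of "zz y" "zz y'"] eq zzU y d(4)
          by fastforce
        then show ?thesis using hi'[OF True] by (simp add: zz_def)
      next
        case False
        then show ?thesis using y by (auto simp: U_def topspace_Euclidean_space)
      qed
    qed
  qed
  have "openin (Euclidean_space k) (\<Phi> ` U)"
    by (rule invariance_of_domain_Euclidean_space_gen[OF kn U cont inj])
  obtain j0 where j0: "j0 < k" "\<beta> j0 = g"
    using bij_betw_imp_surj_on[OF \<beta>] B2(1) by auto
  define y0 where "y0 = (\<lambda>j. if j < n then x (h j) else 0)"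
  have y0U: "y0 \<in> U" using d(1) by (auto simp: U_def y0_def topspace_Euclidean_space)
  have zy0: "zz y0 = x" using hi by (auto simp: zz_def y0_def)
  \<comment> \<open>The line through the image of \<open>x\<close> along which only the coordinate
    belonging to \<open>g\<close> changes. The open image contains a short piece of it.\<close>
  define L where "L = (\<lambda>s j. if j < k then \<beta> j x + of_bool (j = j0) * s else (0::real))"
  have "continuous_map euclideanreal (Euclidean_space k) L"
    unfolding L_def continuous_map_componentwise_Euclidean_space by (auto intro!: continuous_intros)
  from openin_continuous_map_preimage[OF this \<open>openin (Euclidean_space k) (\<Phi> ` U)\<close>]
  have "open {s. L s \<in> \<Phi> ` U}" by simp
  moreover have "0 \<in> {s. L s \<in> \<Phi> ` U}"
  proof -
    have "L 0 = \<Phi> y0" by (auto simp: L_def \<Phi>_def zy0)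
    then show ?thesis using y0U by auto
  qed
  ultimately obtain r where r: "r > 0" "ball 0 r \<subseteq> {s. L s \<in> \<Phi> ` U}"
    unfolding open_contains_ball by auto
  have "r / 2 \<in> ball 0 r" using r(1) by auto
  from subsetD[OF r(2) this] obtain y where y: "y \<in> U" "L (r / 2) = \<Phi> y" by auto
  have val: "\<beta> j (zz y) = \<beta> j x + (if j = j0 then r / 2 else 0)" if "j < k" for j
    using fun_cong[OF y(2), of j] that by (cases "j = j0") (simp_all add: L_def \<Phi>_def)
  have gz: "g (zz y) \<noteq> g x" using val[OF j0(1)] j0 r(1) by auto
  have Bz: "b (zz y) = b x" if "b \<in> B" for b
  proof -
    have "b \<in> \<beta> ` {..<k}" using bij_betw_imp_surj_on[OF \<beta>] B2(1) that by auto
    then obtain j where j: "j < k" "\<beta> j = b" by auto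
    have "j \<noteq> j0" using j j0 gB that by auto
    then show ?thesis using val[OF j(1)] j by simp
  qed
  have "f (zz y) = f x" if "f \<in> F" for f
  proof (rule e1(2)[OF that, unfolded det_def, rule_format])
    fix i assume "i \<in> I"
    then show "\<bar>zz y i - x i\<bar> < e1" using zzU[OF y(1)] d(3) by (meson less_le_trans)
    show "\<bar>x i - x i\<bar> < e1" using e1(1) by simp
  qed (rule Bz)
  moreover have "\<bar>zz y i - x i\<bar> < e" if "i \<in> I" for i
    using zzU[OF y(1) that] d(2) by simp
  ultimately show ?thesis using gz by (intro exI[of _ "zz y"]) auto
qed

subsection \<open>Rigidity as algebraic dependence\<close>

definition config :: "('a \<times> 'd::finite \<Rightarrow> real) \<Rightarrow> 'a \<Rightarrow> real^'d" where
  "config z v = (\<chi> i. z (v, i))"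

definition coords :: "('a \<Rightarrow> real^'d::finite) \<Rightarrow> 'a \<times> 'd \<Rightarrow> real" where
  "coords p = (\<lambda>(v, i). p v $ i)"

text \<open>Squares are used because they are polynomial in the coordinates; equality of distances
  is unaffected.\<close>

definition sqdist :: "'a \<Rightarrow> 'a \<Rightarrow> ('a \<times> 'd::finite \<Rightarrow> real) \<Rightarrow> real" where
  "sqdist u v z = (\<Sum>i\<in>UNIV. (z (u, i) - z (v, i))\<^sup>2)"

definition edge_sqdists :: "'a set set \<Rightarrow> (('a \<times> 'd::finite \<Rightarrow> real) \<Rightarrow> real) set" where
  "edge_sqdists E = {sqdist u v | u v. {u, v} \<in> E}"

definition linked_pair :: "('d::finite) itself \<Rightarrow> 'a set set \<Rightarrow> 'a \<Rightarrow> 'a \<Rightarrow> bool" where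
  "linked_pair _ E u v \<longleftrightarrow> alg_over (edge_sqdists E :: (('a \<times> 'd \<Rightarrow> real) \<Rightarrow> real) set) (sqdist u v)"

lemma config_coords [simp]: "config (coords p) = p" and coords_config [simp]: "coords (config z) = z"
  by (auto simp: config_def coords_def vec_eq_iff)

lemma sqdist_coords: "sqdist u v (coords p) = (dist (p u) (p v))\<^sup>2"
  by (simp add: sqdist_def coords_def dist_vec_def L2_set_def dist_real_def sum_nonneg)

lemma dist_eq_iff_sqdist_eq:
  "dist (p u) (p v) = dist (q u') (q v') \<longleftrightarrow> sqdist u v (coords p) = sqdist u' v' (coords q)"
  by (simp add: sqdist_coords)

lemma sqdist_in_ratpoly: "u \<in> V \<Longrightarrow> v \<in> V \<Longrightarrow> sqdist u v \<in> ratpoly (V \<times> UNIV)"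
  unfolding sqdist_def[abs_def]
  by (intro ratpoly_sum ratpoly_power ratpoly_diff ratpoly.var) auto

lemma is_graph_edgeD: "is_graph V E \<Longrightarrow> {u, v} \<in> E \<Longrightarrow> u \<in> V \<and> v \<in> V \<and> u \<noteq> v"
  unfolding is_graph_def by (metis doubleton_eq_iff)

lemma edge_sqdists_subset: "is_graph V E \<Longrightarrow> edge_sqdists E \<subseteq> ratpoly (V \<times> UNIV)"
  unfolding edge_sqdists_def using is_graph_edgeD by (fastforce intro: sqdist_in_ratpoly)

lemma finite_edge_sqdists: assumes "is_graph V E" shows "finite (edge_sqdists E)"
proof (rule finite_subset)
  show "edge_sqdists E \<subseteq> (\<lambda>(u, v). sqdist u v) ` (V \<times> V)"
    using is_graph_edgeD[OF assms] by (auto simp: edge_sqdists_def)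
  show "finite ((\<lambda>(u, v). sqdist u v) ` (V \<times> V))"
    using assms by (simp add: is_graph_def)
qed

lemma equivalent_iff_edge_sqdists:
  "equivalent E p q \<longleftrightarrow> (\<forall>f\<in>edge_sqdists E. f (coords p) = f (coords q))"
  unfolding equivalent_def edge_sqdists_def dist_eq_iff_sqdist_eq by blast

lemma generic_iff_rat_generic:
  "finite V \<Longrightarrow> generic V p \<longleftrightarrow> rat_generic (V \<times> UNIV) (coords p)"
  unfolding generic_def coords_def by (rule alg_indep_Q_iff_rat_generic) auto

lemma coord_diff_le_dist: "\<bar>coords p (v, i) - coords q (v, i)\<bar> \<le> dist (p v) (q v)"
  using component_le_norm_cart[of "p v - q v" i] by (simp add: coords_def dist_norm)

lemma dist_less_if_coords:
  fixes p q :: "'a \<Rightarrow> real^'d::finite"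
  assumes "\<And>i. \<bar>coords p (v, i) - coords q (v, i)\<bar> < e"
  shows "dist (p v) (q v) < of_nat CARD('d) * e"
proof -
  have "dist (p v) (q v) \<le> (\<Sum>i\<in>UNIV. \<bar>(p v - q v) $ i\<bar>)"
    unfolding dist_norm by (rule norm_le_l1_cart)
  also have "\<dots> < (\<Sum>i\<in>(UNIV::'d set). e)"
    using assms by (intro sum_strict_mono) (auto simp: coords_def)
  finally show ?thesis by simp
qed

lemma generic_dense:
  fixes x :: "'a \<Rightarrow> real^'d::finite"
  assumes V: "finite V" and e: "e > 0"
  shows "\<exists>p :: 'a \<Rightarrow> real^'d. generic V p \<and> (\<forall>v\<in>V. dist (p v) (x v) < e)"
proof -
  let ?e = "e / of_nat CARD('d)"
  have e': "?e > 0" using e by simp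
  obtain y where y: "rat_generic (V \<times> UNIV) y"
    "\<forall>i\<in>V \<times> (UNIV::'d set). coords x i - ?e < y i \<and> y i < coords x i + ?e"
    using rat_generic_dense[of "V \<times> (UNIV :: 'd set)" "\<lambda>i. coords x i - ?e" "\<lambda>i. coords x i + ?e"] V e' by auto
  have "dist (config y v) (x v) < e" if "v \<in> V" for v
  proof -
    have "\<bar>coords (config y) (v, i) - coords x (v, i)\<bar> < ?e" for i
      using y(2)[rule_format, of "(v, i)"] that by auto
    from dist_less_if_coords[of "config y" v x, OF this] show ?thesis by simp
  qed
  then show ?thesis using y(1) V by (intro exI[of _ "config y"]) (auto simp: generic_iff_rat_generic)
qed

lemma generic_extend:
  fixes p x :: "'a \<Rightarrow> real^'d::finite"
  assumes V: "finite V" and S: "S \<subseteq> V" and p: "generic S p" and e: "e > 0"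
  shows "\<exists>q :: 'a \<Rightarrow> real^'d. generic V q \<and> (\<forall>v\<in>S. q v = p v) \<and> (\<forall>v\<in>V - S. dist (q v) (x v) < e)"
proof -
  let ?e = "e / of_nat CARD('d)" and ?I = "S \<times> (UNIV :: 'd set)" and ?J = "(V - S) \<times> (UNIV :: 'd set)"
  have e': "?e > 0" using e by simp
  have fS: "finite S" using V S finite_subset by auto
  have "\<exists>y. rat_generic (?I \<union> ?J) y \<and> (\<forall>i. i \<notin> ?J \<longrightarrow> y i = coords p i) \<and>
     (\<forall>j\<in>?J. coords x j - ?e < y j \<and> y j < coords x j + ?e)"
    using V fS p e' by (intro rat_generic_extend) (auto simp: generic_iff_rat_generic[OF fS])
  then obtain y where y: "rat_generic (?I \<union> ?J) y" "\<forall>i. i \<notin> ?J \<longrightarrow> y i = coords p i"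
     "\<forall>j\<in>?J. coords x j - ?e < y j \<and> y j < coords x j + ?e" by auto
  have "dist (config y v) (x v) < e" if "v \<in> V - S" for v
  proof -
    have "\<bar>coords (config y) (v, i) - coords x (v, i)\<bar> < ?e" for i
      using y(3)[rule_format, of "(v, i)"] that by auto
    from dist_less_if_coords[of "config y" v x, OF this] show ?thesis by simp
  qed
  moreover have "config y v = p v" if "v \<in> S" for v
    using y(2) that by (auto simp: config_def coords_def vec_eq_iff)
  moreover have "?I \<union> ?J = V \<times> UNIV" using S by auto
  ultimately show ?thesis
    using y(1) V by (intro exI[of _ "config y"]) (auto simp: generic_iff_rat_generic)
qed

lemma generic_subset: "finite V \<Longrightarrow> S \<subseteq> V \<Longrightarrow> generic V p \<Longrightarrow> generic S p"
  using finite_subset[of S V] rat_generic_subset[of "V \<times> UNIV" "coords p" "S \<times> UNIV"]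
  by (auto simp: generic_iff_rat_generic)

section \<open>Rigidity expressed by linked pairs\<close>

lemma motion_if_not_linked:
  fixes p :: "'a \<Rightarrow> real^'d::finite"
  assumes G: "is_graph V E" and p: "generic V p" and uv: "u \<in> V" "v \<in> V"
    and nl: "\<not> linked_pair TYPE('d) E u v" and e: "e > 0"
  shows "\<exists>q. equivalent E p q \<and> (\<forall>w\<in>V. dist (p w) (q w) < e) \<and> dist (q u) (q v) \<noteq> dist (p u) (p v)"
proof -
  have V: "finite V" using G by (simp add: is_graph_def)
  let ?e = "e / of_nat CARD('d)"
  have "?e > 0" using e by simp
  then obtain z where z: "\<forall>i\<in>V \<times> UNIV. \<bar>z i - coords p i\<bar> < ?e"
    "\<forall>f\<in>edge_sqdists E. f z = f (coords p)" "sqdist u v z \<noteq> sqdist u v (coords p)"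
    using motion_if_not_alg_over[of "V \<times> UNIV" "coords p" "edge_sqdists E" "sqdist u v" ?e]
      V p G uv nl unfolding linked_pair_def
    by (auto simp: generic_iff_rat_generic finite_edge_sqdists edge_sqdists_subset sqdist_in_ratpoly)
  have "dist (p w) (config z w) < e" if "w \<in> V" for w
  proof -
    have "\<bar>coords p (w, i) - coords (config z) (w, i)\<bar> < ?e" for i
      using z(1)[rule_format, of "(w, i)"] that by (auto simp: abs_minus_commute)
    from dist_less_if_coords[of p w "config z", OF this] show ?thesis by simp
  qed
  then show ?thesis using z
    by (intro exI[of _ "config z"]) (auto simp: equivalent_iff_edge_sqdists dist_eq_iff_sqdist_eq)
qed

text \<open>An unlinked pair would allow the generic rigid framework arbitrarily small motions that
  change its distance.\<close>

lemma rigid_graph_imp_linked_pair: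
  assumes G: "is_graph V E" and rig: "rigid_graph TYPE('d::finite) V E" and uv: "u \<in> V" "v \<in> V"
  shows "linked_pair TYPE('d) E u v"
proof (rule ccontr)
  assume nl: "\<not> ?thesis"
  obtain p :: "'a \<Rightarrow> real^'d" and e where p: "generic V p" "e > 0"
    "\<forall>q. equivalent E p q \<and> (\<forall>v\<in>V. dist (p v) (q v) < e) \<longrightarrow> congruent V p q"
    using rig unfolding rigid_graph_def rigid_framework_def by blast
  obtain q where q: "equivalent E p q" "\<forall>w\<in>V. dist (p w) (q w) < e" "dist (q u) (q v) \<noteq> dist (p u) (p v)"
    using motion_if_not_linked[OF G p(1) uv nl p(2)] by blast
  then have "congruent V p q" using p(3) by blast
  then show False using q(3) uv by (auto simp: congruent_def)
qed

text \<open>Every generic framework serves as witness: each of the finitely many pairs is locally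
  determined by the edge lengths, and the radii have a common positive bound.\<close>

lemma rigid_graph_if_linked_pairs:
  assumes G: "is_graph V E" and all: "\<And>u v. u \<in> V \<Longrightarrow> v \<in> V \<Longrightarrow> linked_pair TYPE('d::finite) E u v"
  shows "rigid_graph TYPE('d) V E"
proof -
  have V: "finite V" using G by (simp add: is_graph_def)
  obtain p :: "'a \<Rightarrow> real^'d" where p: "generic V p"
    using generic_dense[OF V, of 1] by auto
  define P where "P = (\<lambda>(u, v) e. \<forall>z. (\<forall>i\<in>V \<times> UNIV. \<bar>z i - coords p i\<bar> < e) \<longrightarrow>
    (\<forall>f\<in>edge_sqdists E. f z = f (coords p)) \<longrightarrow> sqdist u v z = sqdist u v (coords p))"
  have "\<exists>e>0. \<forall>s\<in>V \<times> V. P s e"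
  proof (rule ex_common_radius)
    fix s assume "s \<in> V \<times> V"
    then obtain u v where s: "s = (u, v)" "u \<in> V" "v \<in> V" by auto
    obtain e where e: "e > 0" "\<forall>z z'. (\<forall>i\<in>V \<times> UNIV. \<bar>z i - coords p i\<bar> < e) \<longrightarrow>
        (\<forall>i\<in>V \<times> UNIV. \<bar>z' i - coords p i\<bar> < e) \<longrightarrow>
        (\<forall>b\<in>edge_sqdists E. b z = b z') \<longrightarrow> sqdist u v z = sqdist u v z'"
      using alg_over_locally_determined[of "V \<times> UNIV" "coords p" "edge_sqdists E" "sqdist u v"]
        p V G s all[of u v] unfolding linked_pair_def
      by (auto simp: generic_iff_rat_generic edge_sqdists_subset sqdist_in_ratpoly)
    have "P s e"
      unfolding P_def s(1) prod.case
    proof (intro allI impI)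
      fix z :: "'a \<times> 'd \<Rightarrow> real"
      assume "\<forall>i\<in>V \<times> UNIV. \<bar>z i - coords p i\<bar> < e" "\<forall>f\<in>edge_sqdists E. f z = f (coords p)"
      then show "sqdist u v z = sqdist u v (coords p)"
        using e(1) by (intro e(2)[rule_format]) auto
    qed
    then show "\<exists>e>0. P s e" using e(1) by blast
  next
    fix s e e' assume "P s e" "e' \<le> e"
    then show "P s e'" unfolding P_def by (cases s) (force intro: less_le_trans)
  qed (use V in simp)
  then obtain e where e: "e > 0" "\<forall>s\<in>V \<times> V. P s e" by auto
  have "rigid_framework V E p"
    unfolding rigid_framework_def
  proof (intro exI[of _ e] conjI allI impI)
    fix q assume "equivalent E p q \<and> (\<forall>v\<in>V. dist (p v) (q v) < e)"
    then have q: "equivalent E p q" "\<forall>v\<in>V. dist (p v) (q v) < e" by auto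
    have "\<bar>coords q i - coords p i\<bar> < e" if "i \<in> V \<times> UNIV" for i
      using that q(2) coord_diff_le_dist[of p _ _ q]
      by (cases i) (auto simp: abs_minus_commute intro: le_less_trans)
    moreover have "f (coords q) = f (coords p)" if "f \<in> edge_sqdists E" for f
      using bspec[OF q(1)[unfolded equivalent_iff_edge_sqdists] that] by (rule sym)
    ultimately have "sqdist u v (coords q) = sqdist u v (coords p)" if "u \<in> V" "v \<in> V" for u v
      using e(2)[rule_format, of "(u, v)"] that unfolding P_def prod.case by blast
    then show "congruent V p q"
      unfolding congruent_def dist_eq_iff_sqdist_eq by auto
  qed (rule e(1))
  then show ?thesis using p unfolding rigid_graph_def by blast
qed

text \<open>Inserting the squared edge lengths of \<open>p\<close> into the coefficients of the
  relation yields one polynomial for the whole fibre of \<open>p\<close>. Its coefficients depend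
  polynomially on \<open>p\<close>, which gives continuity, and a nonzero leading coefficient cannot
  vanish at a generic point.\<close>

lemma linked_pair_polynomial:
  fixes V :: "'a set"
  assumes G: "is_graph V E" and uv: "u \<in> V" "v \<in> V" and l: "linked_pair TYPE('d::finite) E u v"
  obtains A :: "('a \<Rightarrow> real^'d) \<Rightarrow> real poly" and m :: nat where
    "\<And>p. Polynomial.degree (A p) \<le> m" "\<And>p. poly (A p) (sqdist u v (coords p)) = 0"
    "\<And>p q. equivalent E p q \<Longrightarrow> A p = A q"
    "\<And>p. generic V p \<Longrightarrow> Polynomial.coeff (A p) m \<noteq> 0"
    "\<And>k. (\<lambda>z. Polynomial.coeff (A (config z)) k) \<in> ratpoly (V \<times> UNIV)"
proof -
  let ?F = "edge_sqdists E :: (('a \<times> 'd \<Rightarrow> real) \<Rightarrow> real) set"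
  have V: "finite V" using G by (simp add: is_graph_def)
  obtain m a where ma: "(\<forall>i\<le>m. a i \<in> ratpoly ?F) \<and>
     (\<forall>z. (\<Sum>i\<le>m. a i (\<lambda>b. b z) * sqdist u v z ^ i) = 0) \<and> (\<exists>z. a m (\<lambda>b. b z) \<noteq> 0)"
    using l unfolding linked_pair_def alg_over_def by auto
  note ma1 = conjunct1[OF ma, rule_format] and ma2 = conjunct1[OF conjunct2[OF ma], rule_format]
    and ma3 = conjunct2[OF conjunct2[OF ma]]
  define A :: "('a \<Rightarrow> real^'d) \<Rightarrow> real poly" where
    "A = (\<lambda>p. \<Sum>i\<le>m. Polynomial.monom (a i (\<lambda>b. b (coords p))) i)"
  have coeffA: "Polynomial.coeff (A p) k = (if k \<le> m then a k (\<lambda>b. b (coords p)) else 0)" for p k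
    by (simp add: A_def coeff_sum)
  have rp: "(\<lambda>z. Polynomial.coeff (A (config z)) k) \<in> ratpoly (V \<times> UNIV)" for k
  proof (cases "k \<le> m")
    case True
    then have "(\<lambda>z. a k (\<lambda>b. b z)) \<in> ratpoly (V \<times> UNIV)"
      using ma1 edge_sqdists_subset[OF G] by (intro ratpoly_compose[of "a k" ?F "\<lambda>b. b"]) auto
    then show ?thesis using True by (simp add: coeffA)
  qed (simp add: coeffA ratpoly_0)
  show ?thesis
  proof (rule that[of A m])
    show "Polynomial.degree (A p) \<le> m" for p by (rule degree_le) (simp add: coeffA)
    show "poly (A p) (sqdist u v (coords p)) = 0" for p
      using ma2[of "coords p"] by (simp add: A_def poly_sum poly_monom)
    show "A p = A q" if eq: "equivalent E p q" for p q
    proof (rule poly_eqI)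
      fix k
      have "a k (\<lambda>b. b (coords p)) = a k (\<lambda>b. b (coords q))" if k: "k \<le> m"
      proof (rule ratpoly_cong[of "a k" ?F "\<lambda>b. b (coords p)" "\<lambda>b. b (coords q)"])
        show "a k \<in> ratpoly ?F" by (rule ma1[OF k])
        fix f assume "f \<in> ?F"
        then show "f (coords p) = f (coords q)"
          using eq unfolding equivalent_iff_edge_sqdists by (rule bspec[rotated])
      qed
      then show "Polynomial.coeff (A p) k = Polynomial.coeff (A q) k" by (simp add: coeffA)
    qed
    show "Polynomial.coeff (A p) m \<noteq> 0" if "generic V p" for p
    proof
      assume "Polynomial.coeff (A p) m = 0"
      then have "\<forall>z. Polynomial.coeff (A (config z)) m = 0"
        using bspec[OF that[unfolded generic_iff_rat_generic[OF V] rat_generic_def] rp[of m]] by simp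
      then show False using ma3 by (simp add: coeffA)
    qed
  qed (rule rp)
qed

text \<open>All these values are roots of the single nonzero polynomial \<open>A p\<close>.\<close>

lemma finite_linked_distances:
  fixes p :: "'a \<Rightarrow> real^'d::finite"
  assumes "is_graph V E" "u \<in> V" "v \<in> V" "linked_pair TYPE('d) E u v" "generic V p"
  shows "finite {sqdist u v (coords q) | q. equivalent E p q}"
proof -
  obtain A :: "('a \<Rightarrow> real^'d) \<Rightarrow> real poly" and m where A: "\<And>p. poly (A p) (sqdist u v (coords p)) = 0"
    "\<And>p q. equivalent E p q \<Longrightarrow> A p = A q" "\<And>p. generic V p \<Longrightarrow> Polynomial.coeff (A p) m \<noteq> 0"
    using linked_pair_polynomial[OF assms(1-4)] by metis
  have "A p \<noteq> 0" using A(3)[OF assms(5)] by auto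
  then have "finite {t. poly (A p) t = 0}" by (rule poly_roots_finite)
  moreover have "{sqdist u v (coords q) | q. equivalent E p q} \<subseteq> {t. poly (A p) t = 0}"
    using A(1,2) by force
  ultimately show ?thesis by (rule finite_subset[rotated])
qed

subsection \<open>Sides of a clique sum and compactness of fibres\<close>

text \<open>The reflection in the perpendicular bisector of \<open>a\<close> and \<open>b\<close>,
  which fixes its mirror pointwise.\<close>

lemma reflection_swapping_points:
  fixes a b :: "'e::real_inner"
  assumes "a \<noteq> b"
  shows "\<exists>R. (\<forall>x y. dist (R x) (R y) = dist x y) \<and> R a = b \<and> (\<forall>x. dist x a = dist x b \<longrightarrow> R x = x)"
proof -
  define n where "n = b - a"
  have n: "n \<bullet> n \<noteq> 0" using assms by (simp add: n_def)
  define R where "R = (\<lambda>x. x - (2 * ((x - (1/2) *\<^sub>R (a + b)) \<bullet> n) / (n \<bullet> n)) *\<^sub>R n)"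
  have "dist (R x) (R y) = dist x y" for x y
  proof -
    define w where "w = x - y"
    have "R x - R y = w - (2 * (w \<bullet> n) / (n \<bullet> n)) *\<^sub>R n"
      by (simp add: R_def w_def inner_diff_left algebra_simps diff_divide_distrib)
    moreover have "(w - (2 * (w \<bullet> n) / (n \<bullet> n)) *\<^sub>R n) \<bullet> (w - (2 * (w \<bullet> n) / (n \<bullet> n)) *\<^sub>R n) = w \<bullet> w"
      using n by (simp add: inner_diff_left inner_diff_right inner_commute field_simps)
    ultimately show ?thesis by (simp add: dist_norm norm_eq_sqrt_inner w_def)
  qed
  moreover have "R a = b"
  proof -
    have "a - (1/2) *\<^sub>R (a + b) = (-1/2) *\<^sub>R n"
    proof -
      have "a = (1/2 + 1/2) *\<^sub>R a" by simp
      then have "a = (1/2) *\<^sub>R a + (1/2) *\<^sub>R a" by (metis scaleR_add_left)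
      then show ?thesis by (simp add: n_def algebra_simps)
    qed
    then have "R a = a - (2 * (((-1/2) *\<^sub>R n) \<bullet> n) / (n \<bullet> n)) *\<^sub>R n" by (simp only: R_def)
    also have "\<dots> = a + n" using n by simp
    finally show ?thesis by (simp add: n_def)
  qed
  moreover have "R x = x" if "dist x a = dist x b" for x
  proof -
    have "(x - a) \<bullet> (x - a) = (x - b) \<bullet> (x - b)"
      using that by (simp add: dist_norm norm_eq_sqrt_inner)
    then have "(x - (1/2) *\<^sub>R (a + b)) \<bullet> n = 0"
      by (simp add: n_def inner_diff_left inner_diff_right inner_add_left inner_commute algebra_simps)
    then show ?thesis by (simp add: R_def)
  qed
  ultimately show ?thesis by blast
qed

text \<open>Points are matched one by one. An already matched point is equidistant from the current
  image of the new point and from its target, so it lies on the mirror of the correcting reflection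
  and stays fixed.\<close>

lemma congruent_imp_isometry:
  fixes p q :: "'a \<Rightarrow> 'e::real_inner"
  assumes "finite K" "\<And>u v. u \<in> K \<Longrightarrow> v \<in> K \<Longrightarrow> dist (p u) (p v) = dist (q u) (q v)"
  shows "\<exists>T. (\<forall>x y. dist (T x) (T y) = dist x y) \<and> (\<forall>k\<in>K. T (p k) = q k)"
  using assms
proof (induction K rule: finite_induct)
  case empty
  then show ?case by (intro exI[of _ id]) auto
next
  case (insert k K)
  have "\<exists>T. (\<forall>x y. dist (T x) (T y) = dist x y) \<and> (\<forall>k\<in>K. T (p k) = q k)"
    using insert.prems by (intro insert.IH) auto
  then obtain T where T: "\<And>x y. dist (T x) (T y) = dist x y" "\<And>l. l \<in> K \<Longrightarrow> T (p l) = q l"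
    by auto
  show ?case
  proof (cases "T (p k) = q k")
    case True
    then show ?thesis using T by (intro exI[of _ T]) auto
  next
    case False
    obtain R where R: "\<And>x y. dist (R x) (R y) = dist x y" "R (T (p k)) = q k"
      "\<And>x. dist x (T (p k)) = dist x (q k) \<Longrightarrow> R x = x"
      using reflection_swapping_points[OF False] by auto
    have "R (T (p l)) = q l" if "l \<in> K" for l
    proof -
      have "dist (q l) (T (p k)) = dist (p l) (p k)"
        using T(1)[of "p l" "p k"] T(2)[OF that] by simp
      also have "\<dots> = dist (q l) (q k)" using insert.prems that by auto
      finally show ?thesis using R(3) T(2)[OF that] by simp
    qed
    then show ?thesis using R(1,2) T(1) by (intro exI[of _ "\<lambda>x. R (T x)"]) auto
  qed
qed

text \<open>The finitely many attainable distances leave a gap around the given one. Closeness is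
  required at \<open>u\<close> and \<open>v\<close> only, so the other vertices may move
  far.\<close>

lemma linked_distances_isolated:
  fixes p :: "'a \<Rightarrow> real^'d::finite"
  assumes "is_graph V E" "u \<in> V" "v \<in> V" "linked_pair TYPE('d) E u v" "generic V p"
  shows "\<exists>e>0. \<forall>q. equivalent E p q \<longrightarrow> dist (p u) (q u) < e \<longrightarrow> dist (p v) (q v) < e \<longrightarrow>
    dist (q u) (q v) = dist (p u) (p v)"
proof -
  let ?S = "{sqdist u v (coords q) | q. equivalent E p q}"
  have "finite (sqrt ` ?S)" using finite_linked_distances[OF assms] by simp
  from finite_set_avoid[OF this, of "dist (p u) (p v)"] obtain d where d: "d > 0"
    "\<And>x. x \<in> sqrt ` ?S \<Longrightarrow> x \<noteq> dist (p u) (p v) \<Longrightarrow> d \<le> dist (dist (p u) (p v)) x" by auto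
  show ?thesis
  proof (intro exI[of _ "d / 2"] conjI allI impI)
    fix q assume q: "equivalent E p q" "dist (p u) (q u) < d / 2" "dist (p v) (q v) < d / 2"
    have "\<bar>dist (p u) (p v) - dist (q u) (q v)\<bar> \<le> dist (p u) (q u) + dist (p v) (q v)"
      by (smt (verit) dist_commute dist_triangle)
    then have "dist (dist (p u) (p v)) (dist (q u) (q v)) < d" using q by (simp add: dist_real_def)
    moreover have "dist (q u) (q v) \<in> sqrt ` ?S"
      by (rule image_eqI[of _ _ "sqdist u v (coords q)"]) (use q in \<open>auto simp: sqdist_coords\<close>)
    ultimately show "dist (q u) (q v) = dist (p u) (p v)" using d(2) by fastforce
  qed (use d in simp)
qed

text \<open>A motion of one side preserves the distances within the clique, hence extends over the
  other side by an isometry. The isometry may carry that side far away, so the contradiction comes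
  from \<open>linked_distances_isolated\<close> and not from the definition of rigidity.\<close>

lemma rigid_graph_clique_sum_side:
  assumes G1: "is_graph V1 E1" and G2: "is_graph V2 E2" and K: "is_clique E1 (V1 \<inter> V2)"
    and rig: "rigid_graph TYPE('d::finite) (V1 \<union> V2) (E1 \<union> E2)"
  shows "rigid_graph TYPE('d) V1 E1"
proof (rule rigid_graph_if_linked_pairs[OF G1], rule ccontr)
  let ?V = "V1 \<union> V2" and ?E = "E1 \<union> E2"
  fix u v assume uv: "u \<in> V1" "v \<in> V1" and nl: "\<not> linked_pair TYPE('d) E1 u v"
  have G: "is_graph ?V ?E" using G1 G2 unfolding is_graph_def by fast
  have fV: "finite ?V" "finite V1" using G G1 by (auto simp: is_graph_def)
  obtain p :: "'a \<Rightarrow> real^'d" where p: "generic ?V p"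
    using rig unfolding rigid_graph_def by auto
  have l: "linked_pair TYPE('d) ?E u v"
    using rigid_graph_imp_linked_pair[OF G rig] uv by auto
  obtain e where e: "e > 0" "\<And>q. equivalent ?E p q \<Longrightarrow> dist (p u) (q u) < e \<Longrightarrow> dist (p v) (q v) < e \<Longrightarrow>
    dist (q u) (q v) = dist (p u) (p v)"
    using linked_distances_isolated[OF G _ _ l p] uv by auto
  have "generic V1 p" using generic_subset[OF fV(1) _ p] by auto
  then obtain q where q: "equivalent E1 p q" "\<forall>w\<in>V1. dist (p w) (q w) < e" "dist (q u) (q v) \<noteq> dist (p u) (p v)"
    using motion_if_not_linked[OF G1 _ uv nl e(1)] by auto
  have "dist (p a) (p b) = dist (q a) (q b)" if "a \<in> V1 \<inter> V2" "b \<in> V1 \<inter> V2" for a b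
    using that q(1) K by (cases "a = b") (auto simp: is_clique_def equivalent_def)
  then have "\<exists>T. (\<forall>x y. dist (T x) (T y) = dist x y) \<and> (\<forall>k\<in>V1 \<inter> V2. T (p k) = q k)"
    using fV by (intro congruent_imp_isometry) auto
  then obtain T where T: "\<And>x y. dist (T x) (T y) = dist x y"
    "\<And>k. k \<in> V1 \<inter> V2 \<Longrightarrow> T (p k) = q k" by auto
  define r where "r = (\<lambda>w. if w \<in> V1 then q w else T (p w))"
  have r2: "r w = T (p w)" if "w \<in> V2" for w using T(2) that by (auto simp: r_def)
  have "equivalent ?E p r"
    unfolding equivalent_def
  proof (intro allI impI)
    fix a b assume "{a, b} \<in> ?E"
    then show "dist (p a) (p b) = dist (r a) (r b)"
    proof
      assume ab: "{a, b} \<in> E1"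
      then show ?thesis using q(1) is_graph_edgeD[OF G1 ab] by (auto simp: equivalent_def r_def)
    next
      assume ab: "{a, b} \<in> E2"
      then show ?thesis using is_graph_edgeD[OF G2 ab] by (simp add: r2 T(1))
    qed
  qed
  then show False using e(2)[of r] q(2,3) uv by (simp add: r_def)
qed

text \<open>Without a crossing edge, \<open>C\<close> could be translated by itself. In this form
  the lemma also serves to spread a property along edges.\<close>

lemma rigid_graph_cut_edge:
  assumes G: "is_graph V E" and rig: "rigid_graph TYPE('d::finite) V E"
    and C: "C \<subseteq> V" "C \<noteq> {}" "C \<noteq> V"
  shows "\<exists>a\<in>C. \<exists>b\<in>V - C. {a, b} \<in> E"
proof (rule ccontr)
  assume no: "\<not> ?thesis"
  obtain a b where ab: "a \<in> C" "b \<in> V - C" using C by auto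
  obtain p :: "'a \<Rightarrow> real^'d" and e where p: "e > 0"
    "\<forall>q. equivalent E p q \<and> (\<forall>v\<in>V. dist (p v) (q v) < e) \<longrightarrow> congruent V p q"
    using rig unfolding rigid_graph_def rigid_framework_def by auto
  \<comment> \<open>The translation has to change a distance across the cut: \<open>p a\<close>
    moves straight away from \<open>p b\<close>, or in any direction if the two coincide.\<close>
  obtain w where w: "w \<noteq> 0" "\<And>t. t > 0 \<Longrightarrow> dist (p a + t *\<^sub>R w) (p b) \<noteq> dist (p a) (p b)"
  proof (cases "p a = p b")
    case True
    have "axis undefined 1 \<noteq> (0 :: real^'d)" by (simp add: axis_eq_0_iff)
    then show ?thesis using True by (intro that[of "axis undefined 1"]) (auto simp: dist_norm)
  next
    case False
    have "dist (p a + t *\<^sub>R (p a - p b)) (p b) \<noteq> dist (p a) (p b)" if "t > 0" for t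
    proof -
      have "p a + t *\<^sub>R (p a - p b) - p b = (1 + t) *\<^sub>R (p a - p b)" by (simp add: algebra_simps)
      then have "dist (p a + t *\<^sub>R (p a - p b)) (p b) = (1 + t) * dist (p a) (p b)"
        using that by (simp add: dist_norm)
      then show ?thesis using that False by simp
    qed
    then show ?thesis using False by (intro that[of "p a - p b"]) auto
  qed
  define t where "t = e / (2 * norm w)"
  have t: "t > 0" "norm (t *\<^sub>R w) < e" using p(1) w(1) by (auto simp: t_def)
  define q where "q = (\<lambda>v. if v \<in> C then p v + t *\<^sub>R w else p v)"
  have "equivalent E p q"
    unfolding equivalent_def
  proof (intro allI impI)
    fix x y assume xy: "{x, y} \<in> E"
    then have "{y, x} \<in> E" by (simp add: insert_commute)
    then have "x \<in> C \<longleftrightarrow> y \<in> C"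
      using no xy is_graph_edgeD[OF G xy] by blast
    then show "dist (p x) (p y) = dist (q x) (q y)" by (auto simp: q_def)
  qed
  moreover have "\<forall>v\<in>V. dist (p v) (q v) < e" using t p(1) by (auto simp: q_def dist_norm)
  ultimately have "congruent V p q" using p(2) by blast
  then have "dist (p a) (p b) = dist (q a) (q b)" using ab C(1) by (auto simp: congruent_def)
  then show False using w(2)[OF t(1)] ab by (auto simp: q_def)
qed

section \<open>Compactness of fibres up to translation\<close>

lemma finite_family_convergent_subseq:
  fixes R :: "nat \<Rightarrow> 'a \<Rightarrow> 'e::heine_borel"
  assumes "finite V" "\<And>w. w \<in> V \<Longrightarrow> bounded (range (\<lambda>n. R n w))"
  shows "\<exists>r l. strict_mono r \<and> (\<forall>w\<in>V. (\<lambda>n. R (r n) w) \<longlonglongrightarrow> l w)"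
  using assms
proof (induction V rule: finite_induct)
  case empty
  then show ?case by (intro exI[of _ id]) (auto simp: strict_mono_def)
next
  case (insert v V)
  have "\<exists>r l. strict_mono r \<and> (\<forall>w\<in>V. (\<lambda>n. R (r n) w) \<longlonglongrightarrow> l w)"
    using insert.prems by (intro insert.IH) auto
  then obtain r l where r: "strict_mono r" "\<And>w. w \<in> V \<Longrightarrow> (\<lambda>n. R (r n) w) \<longlonglongrightarrow> l w" by auto
  have "bounded (range (\<lambda>n. R (r n) v))"
    by (rule bounded_subset[OF insert.prems[of v]]) auto
  then obtain x s where s: "strict_mono s" "((\<lambda>n. R (r n) v) \<circ> s) \<longlonglongrightarrow> x"
    using bounded_imp_convergent_subsequence by blast
  show ?case
  proof (intro exI[of _ "r \<circ> s"] exI[of _ "l(v := x)"] conjI ballI)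
    show "strict_mono (r \<circ> s)" by (rule strict_mono_o[OF r(1) s(1)])
    fix w assume "w \<in> insert v V"
    then show "(\<lambda>n. R ((r \<circ> s) n) w) \<longlonglongrightarrow> (l(v := x)) w"
      using s(2) LIMSEQ_subseq_LIMSEQ[OF r(2) s(1)] insert.hyps by (auto simp: o_def)
  qed
qed

text \<open>Otherwise frameworks with too small values, on fibres approaching that of
  \<open>x\<close>, would have a limit on the fibre of \<open>x\<close> itself. The point
  \<open>x\<close> may be non-generic, as it will be a minimizer.\<close>

lemma fibre_minimum_lower_semicontinuous:
  fixes x :: "'a \<Rightarrow> real^'d::finite"
  assumes G: "is_graph V E" and rig: "rigid_graph TYPE('d) V E" and uv: "u \<in> V" "v \<in> V"
    and min: "\<And>q. equivalent E x q \<Longrightarrow> t \<le> sqdist u v (coords q)" and \<eta>: "\<eta> > 0"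
  shows "\<exists>e>0. \<forall>p q. (\<forall>w\<in>V. dist (p w) (x w) < e) \<longrightarrow> equivalent E p q \<longrightarrow> t - \<eta> \<le> sqdist u v (coords q)"
proof (rule ccontr)
  assume no: "\<not> ?thesis"
  have "\<exists>p q. (\<forall>w\<in>V. dist (p w) (x w) < 1 / of_nat (Suc n)) \<and> equivalent E p q \<and> sqdist u v (coords q) < t - \<eta>" for n
  proof -
    have "(0::real) < 1 / of_nat (Suc n)" by simp
    with no show ?thesis by (meson not_le)
  qed
  then obtain P Q where PQ: "\<And>n w. w \<in> V \<Longrightarrow> dist (P n w) (x w) < 1 / of_nat (Suc n)"
    "\<And>n. equivalent E (P n) (Q n)" "\<And>n. sqdist u v (coords (Q n)) < t - \<eta>" by metis
  have Plim: "(\<lambda>n. P n w) \<longlonglongrightarrow> x w" if "w \<in> V" for w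
  proof (rule tendstoI)
    fix e :: real assume "e > 0"
    then obtain N where N: "1 / of_nat (Suc N) < e" using nat_approx_posE by blast
    show "\<forall>\<^sub>F n in sequentially. dist (P n w) (x w) < e"
      unfolding eventually_sequentially
    proof (intro exI[of _ N] allI impI)
      fix n assume "N \<le> n"
      then have "1 / of_nat (Suc n) \<le> (1 / of_nat (Suc N) :: real)" by (intro divide_left_mono) auto
      then show "dist (P n w) (x w) < e" using PQ(1)[OF that, of n] N by linarith
    qed
  qed
  \<comment> \<open>Fibres are invariant under translations, so compactness requires pinning one
    vertex: \<open>u\<close> is placed at the origin.\<close>
  define R where "R = (\<lambda>n w. Q n w - Q n u)"
  have dR: "dist (R n a) (R n b) = dist (Q n a) (Q n b)" for n a b by (simp add: R_def dist_norm)
  have dE: "dist (R n a) (R n b) = dist (P n a) (P n b)" if "{a, b} \<in> E" for n a b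
    using PQ(2)[of n] that unfolding equivalent_def dR by simp
  \<comment> \<open>Edge lengths stay bounded because the \<open>P n\<close> converge, so
    boundedness spreads from \<open>u\<close> over an edge across every cut.\<close>
  define W where "W = {w \<in> V. bounded (range (\<lambda>n. R n w))}"
  have "W = V"
  proof (rule ccontr)
    assume "W \<noteq> V"
    moreover have "u \<in> W" using uv by (simp add: W_def R_def image_constant_conv)
    moreover have "W \<subseteq> V" by (auto simp: W_def)
    ultimately obtain a b where ab: "a \<in> W" "b \<in> V - W" "{a, b} \<in> E"
      using rigid_graph_cut_edge[OF G rig, of W] by blast
    have bP: "bounded (range (\<lambda>n. P n w))" if "w \<in> V" for w
      using Plim[OF that] by (rule convergent_imp_bounded)
    obtain B1 where B1: "\<And>n. norm (P n a) \<le> B1"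
      using bP[of a] ab by (auto simp: W_def bounded_iff)
    obtain B2 where B2: "\<And>n. norm (P n b) \<le> B2"
      using bP[of b] ab by (auto simp: bounded_iff)
    obtain B3 where B3: "\<And>n. norm (R n a) \<le> B3"
      using ab by (auto simp: W_def bounded_iff)
    have "norm (R n b) \<le> B3 + (B1 + B2)" for n
    proof -
      have "norm (R n b) \<le> norm (R n a) + dist (R n a) (R n b)"
        by (metis dist_norm norm_triangle_sub dist_commute)
      also have "dist (R n a) (R n b) \<le> norm (P n a) + norm (P n b)"
        using dE[OF ab(3), of n] norm_triangle_ineq4[of "P n a" "P n b"] by (simp add: dist_norm)
      finally show ?thesis using B1[of n] B2[of n] B3[of n] by linarith
    qed
    then have "b \<in> W" using ab by (auto simp: W_def bounded_iff)
    then show False using ab by simp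
  qed
  have "\<exists>r l. strict_mono r \<and> (\<forall>w\<in>V. (\<lambda>n. R (r n) w) \<longlonglongrightarrow> l w)"
  proof (rule finite_family_convergent_subseq)
    show "finite V" using G by (simp add: is_graph_def)
    show "bounded (range (\<lambda>n. R n w))" if "w \<in> V" for w
      using that \<open>W = V\<close> unfolding W_def by blast
  qed
  then obtain r l where r: "strict_mono r" "\<And>w. w \<in> V \<Longrightarrow> (\<lambda>n. R (r n) w) \<longlonglongrightarrow> l w"
    by auto
  have "equivalent E x l"
    unfolding equivalent_def
  proof (intro allI impI)
    fix a b assume ab: "{a, b} \<in> E"
    then have V: "a \<in> V" "b \<in> V" using is_graph_edgeD[OF G] by auto
    have "(\<lambda>n. dist (P (r n) a) (P (r n) b)) \<longlonglongrightarrow> dist (x a) (x b)"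
      using LIMSEQ_subseq_LIMSEQ[OF Plim[OF V(1)] r(1)] LIMSEQ_subseq_LIMSEQ[OF Plim[OF V(2)] r(1)]
      by (intro tendsto_dist) (auto simp: o_def)
    moreover have "(\<lambda>n. dist (P (r n) a) (P (r n) b)) \<longlonglongrightarrow> dist (l a) (l b)"
      unfolding dE[OF ab, symmetric] using r(2) V by (intro tendsto_dist) auto
    ultimately show "dist (x a) (x b) = dist (l a) (l b)" by (rule LIMSEQ_unique)
  qed
  then have "t \<le> (dist (l u) (l v))\<^sup>2" using min by (simp add: sqdist_coords)
  moreover have "(dist (l u) (l v))\<^sup>2 \<le> t - \<eta>"
  proof (rule LIMSEQ_le_const2)
    show "(\<lambda>n. (dist (R (r n) u) (R (r n) v))\<^sup>2) \<longlonglongrightarrow> (dist (l u) (l v))\<^sup>2"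
      using r(2) uv by (intro tendsto_power tendsto_dist) auto
    show "\<exists>N. \<forall>n\<ge>N. (dist (R (r n) u) (R (r n) v))\<^sup>2 \<le> t - \<eta>"
      using PQ(3) by (auto simp: dR sqdist_coords intro: less_imp_le)
  qed
  ultimately show False using \<eta> by simp
qed

subsection \<open>Generic frameworks minimizing a distance\<close>

lemma higher_pderiv_nonzero_at:
  fixes P :: "real poly"
  assumes "P \<noteq> 0"
  shows "\<exists>j. poly ((Polynomial.pderiv ^^ j) P) t \<noteq> 0"
  using assms
proof (induction "Polynomial.degree P" arbitrary: P)
  case 0
  then obtain c where "P = [:c:]" using degree_eq_zeroE by metis
  then show ?case using 0 by (intro exI[of _ 0]) auto
next
  case (Suc n)
  have "Polynomial.pderiv P \<noteq> 0" using Suc(2) by (simp add: pderiv_eq_0_iff)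
  moreover have "n = Polynomial.degree (Polynomial.pderiv P)" using Suc(2) by (simp add: degree_pderiv)
  ultimately obtain j where "poly ((Polynomial.pderiv ^^ j) (Polynomial.pderiv P)) t \<noteq> 0"
    using Suc(1) by blast
  then show ?case by (intro exI[of _ "Suc j"]) (simp add: funpow_swap1)
qed

text \<open>Repeated Rolle: each derivative lowers the order of the zero at \<open>t\<close> by one
  and keeps another root strictly between \<open>t\<close> and the previous one, so never
  \<open>t\<close> itself.\<close>

lemma higher_pderiv_root_between:
  fixes P :: "real poly"
  assumes "\<And>i. i < j \<Longrightarrow> poly ((Polynomial.pderiv ^^ i) P) t = 0" "poly P s = 0" "s \<noteq> t"
  shows "\<exists>y. min s t \<le> y \<and> y \<le> max s t \<and> y \<noteq> t \<and> poly ((Polynomial.pderiv ^^ j) P) y = 0"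
  using assms
proof (induction j arbitrary: P s)
  case 0
  then show ?case by (intro exI[of _ s]) auto
next
  case (Suc j)
  have t0: "poly P t = 0" using Suc.prems(1)[of 0] by simp
  have "\<exists>y. min s t < y \<and> y < max s t \<and> poly P (max s t) - poly P (min s t) = (max s t - min s t) * poly (Polynomial.pderiv P) y"
    using Suc.prems(3) by (intro poly_MVT) auto
  then obtain y where y: "min s t < y" "y < max s t" "poly (Polynomial.pderiv P) y = 0"
    using Suc.prems(2,3) t0 by (auto simp: max_def min_def split: if_splits)
  have "poly ((Polynomial.pderiv ^^ i) (Polynomial.pderiv P)) t = 0" if "i < j" for i
    using Suc.prems(1)[of "Suc i"] that by (simp add: funpow_swap1)
  moreover have "y \<noteq> t" using y(1,2) by auto
  ultimately obtain x where "min y t \<le> x" "x \<le> max y t" "x \<noteq> t"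
      "poly ((Polynomial.pderiv ^^ j) (Polynomial.pderiv P)) x = 0"
    using Suc.IH[of "Polynomial.pderiv P" y] y(3) by auto
  then show ?case using y by (intro exI[of _ x]) (auto simp: funpow_swap1)
qed

lemma poly_eq_sum_if_degree_le:
  fixes x :: "'a::comm_semiring_1"
  assumes "Polynomial.degree P \<le> m"
  shows "poly P x = (\<Sum>i\<le>m. Polynomial.coeff P i * x ^ i)"
  unfolding poly_altdef using assms by (intro sum.mono_neutral_left) (auto simp: coeff_eq_0)

text \<open>With a common degree bound, evaluation is a sum of fixed length, so convergence of the
  single coefficients suffices; differentiation preserves these assumptions.\<close>

lemma tendsto_higher_pderiv:
  fixes B :: "'b \<Rightarrow> real poly"
  assumes "\<And>y. Polynomial.degree (B y) \<le> m" "Polynomial.degree b \<le> m"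
    and "\<And>k. ((\<lambda>y. Polynomial.coeff (B y) k) \<longlongrightarrow> Polynomial.coeff b k) F"
    and s: "(s \<longlongrightarrow> t) F"
  shows "((\<lambda>y. poly ((Polynomial.pderiv ^^ j) (B y)) (s y)) \<longlongrightarrow> poly ((Polynomial.pderiv ^^ j) b) t) F"
  using assms(1-3)
proof (induction j arbitrary: B b)
  case 0
  have "((\<lambda>y. \<Sum>i\<le>m. Polynomial.coeff (B y) i * s y ^ i) \<longlongrightarrow> (\<Sum>i\<le>m. Polynomial.coeff b i * t ^ i)) F"
    by (intro tendsto_intros 0 s)
  then show ?case by (simp add: poly_eq_sum_if_degree_le[OF 0(1)] poly_eq_sum_if_degree_le[OF 0(2)])
next
  case (Suc j)
  have "((\<lambda>y. poly ((Polynomial.pderiv ^^ j) (Polynomial.pderiv (B y))) (s y))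
      \<longlongrightarrow> poly ((Polynomial.pderiv ^^ j) (Polynomial.pderiv b)) t) F"
  proof (rule Suc.IH)
    show "Polynomial.degree (Polynomial.pderiv (B y)) \<le> m" for y
      using Suc.prems(1)[of y] by (simp add: degree_pderiv)
    show "Polynomial.degree (Polynomial.pderiv b) \<le> m"
      using Suc.prems(2) by (simp add: degree_pderiv)
    show "((\<lambda>y. Polynomial.coeff (Polynomial.pderiv (B y)) k) \<longlongrightarrow> Polynomial.coeff (Polynomial.pderiv b) k) F" for k
      unfolding coeff_pderiv by (intro tendsto_intros Suc.prems)
  qed
  then show ?case by (simp add: funpow_swap1)
qed

lemma eventually_near_coords:
  fixes x :: "'a \<Rightarrow> real^'d::finite"
  assumes "eventually P (near (V \<times> UNIV) (coords x))"
  shows "\<exists>e>0. \<forall>p. (\<forall>w\<in>V. dist (p w) (x w) < e) \<longrightarrow> P (coords p)"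
proof -
  obtain e where e: "e > 0" "\<And>z. (\<forall>i\<in>V \<times> UNIV. \<bar>z i - coords x i\<bar> < e) \<Longrightarrow> P z"
    using assms unfolding eventually_near by auto
  have "P (coords p)" if "\<forall>w\<in>V. dist (p w) (x w) < e" for p
    using that coord_diff_le_dist[of p _ _ x] by (intro e(2)) (auto intro: le_less_trans)
  then show ?thesis using e(1) by auto
qed

text \<open>The multiplicity of the minimal squared distance on the fibre of p, as a root of the
  relation A p, is chosen as small as possible. Near a minimizer this multiplicity cannot drop, so
  the minimum stays the only root in a neighbourhood, and every nearby generic framework attains
  the minimum on its own fibre.\<close>

lemma generic_fibre_minimizer:
  fixes V :: "'a set"
  assumes G: "is_graph V E" and rig: "rigid_graph TYPE('d::finite) V E" and uv: "u \<in> V" "v \<in> V"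
  shows "\<exists>(p :: 'a \<Rightarrow> real^'d) \<delta>. generic V p \<and> \<delta> > 0 \<and> (\<forall>q. equivalent E p q \<longrightarrow>
    sqdist u v (coords q) = sqdist u v (coords p) \<or> sqdist u v (coords p) + \<delta> \<le> sqdist u v (coords q))"
proof -
  have V: "finite V" using G by (simp add: is_graph_def)
  have l: "linked_pair TYPE('d) E u v" by (rule rigid_graph_imp_linked_pair[OF G rig uv])
  obtain A :: "('a \<Rightarrow> real^'d) \<Rightarrow> real poly" and m where
    deg: "\<And>p. Polynomial.degree (A p) \<le> m" and root: "\<And>p. poly (A p) (sqdist u v (coords p)) = 0"
    and A_eq: "\<And>p q. equivalent E p q \<Longrightarrow> A p = A q"
    and lead: "\<And>p. generic V p \<Longrightarrow> Polynomial.coeff (A p) m \<noteq> 0"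
    and rp: "\<And>k. (\<lambda>z. Polynomial.coeff (A (config z)) k) \<in> ratpoly (V \<times> UNIV)"
    by (rule linked_pair_polynomial[OF G uv l]) (rule that)
  define Val where "Val = (\<lambda>p :: 'a \<Rightarrow> real^'d. {sqdist u v (coords q) | q. equivalent E p q})"
  have self: "sqdist u v (coords p) \<in> Val p" for p unfolding Val_def equivalent_def by blast
  define mn where "mn p = Min (Val p)" for p
  have fin: "finite (Val p)" if "generic V p" for p
    unfolding Val_def by (rule finite_linked_distances[OF G uv l that])
  have mn_in: "mn p \<in> Val p" if "generic V p" for p
    unfolding mn_def using fin[OF that] self[of p] by (intro Min_in) auto
  have mn_le: "mn p \<le> t" if "generic V p" "t \<in> Val p" for p t
    unfolding mn_def using fin[OF that(1)] that(2) by (rule Min_le)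
  \<comment> \<open>The order of \<open>mn p\<close> as a root of \<open>A p\<close>, which is a
    nonzero polynomial when \<open>p\<close> is generic.\<close>
  define mult where "mult p = (LEAST j. poly ((Polynomial.pderiv ^^ j) (A p)) (mn p) \<noteq> 0)" for p
  have mult: "poly ((Polynomial.pderiv ^^ mult p) (A p)) (mn p) \<noteq> 0" if "generic V p" for p
  proof -
    have "A p \<noteq> 0" using lead[OF that] by auto
    from higher_pderiv_nonzero_at[OF this] show ?thesis unfolding mult_def by (rule LeastI_ex)
  qed
  have below_mult: "poly ((Polynomial.pderiv ^^ i) (A p)) (mn p) = 0" if "i < mult p" for i p
    using not_less_Least[OF that[unfolded mult_def]] by simp
  obtain p0 :: "'a \<Rightarrow> real^'d" where "generic V p0" using generic_dense[OF V, of 1] by auto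
  from ex_has_least_nat[of "generic V" p0 mult, OF this]
  obtain p where p: "generic V p" and least: "\<And>p'. generic V p' \<Longrightarrow> mult p \<le> mult p'" by auto
  define t where "t = mn p"
  \<comment> \<open>This minimizer may fail to be generic. It is only the centre around which the
    generic \<open>p'\<close> is chosen; lying on the fibre of \<open>p\<close>, it has the same
    polynomial.\<close>
  obtain x where x: "equivalent E p x" "sqdist u v (coords x) = t"
    using mn_in[OF p] by (auto simp: Val_def t_def)
  have Ax: "A x = A p" using A_eq[OF x(1)] by simp
  let ?D = "\<lambda>q s. poly ((Polynomial.pderiv ^^ mult p) (A q)) s"
  let ?F = "near (V \<times> UNIV) (coords x) \<times>\<^sub>F nhds t"
  have "((\<lambda>y. ?D (config (fst y)) (snd y)) \<longlongrightarrow> ?D x t) ?F"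
  proof (rule tendsto_higher_pderiv[OF deg deg])
    fix k
    have "((\<lambda>z. Polynomial.coeff (A (config z)) k) \<longlongrightarrow> Polynomial.coeff (A x) k) (near (V \<times> UNIV) (coords x))"
      using tendsto_near_ratpoly[OF rp[of k], of "coords x"] by simp
    then show "((\<lambda>y. Polynomial.coeff (A (config (fst y))) k) \<longlongrightarrow> Polynomial.coeff (A x) k) ?F"
      by (rule filterlim_compose[OF _ filterlim_fst])
    show "(snd \<longlongrightarrow> t) ?F" by (rule filterlim_snd)
  qed
  moreover have "?D x t \<noteq> 0" using mult[OF p] by (simp add: Ax t_def)
  ultimately have "\<forall>\<^sub>F y in ?F. ?D (config (fst y)) (snd y) \<noteq> 0"
    by (rule tendsto_imp_eventually_ne)
  then obtain P1 P2 where P: "eventually P1 (near (V \<times> UNIV) (coords x))" "eventually P2 (nhds t)"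
    "\<And>z s. P1 z \<Longrightarrow> P2 s \<Longrightarrow> ?D (config z) s \<noteq> 0"
    unfolding eventually_prod_filter by auto
  \<comment> \<open>Around \<open>t\<close> this window contains no zero of the derivative of order
    \<open>mult p\<close>. Half of it keeps the value of \<open>p'\<close> close to \<open>t\<close>
    and its whole fibre above \<open>t - \<eta> / 2\<close>; the other half becomes the gap.\<close>
  obtain \<eta> where \<eta>: "\<eta> > 0" "\<And>s. \<bar>s - t\<bar> < \<eta> \<Longrightarrow> P2 s"
    using P(2) unfolding eventually_nhds_metric dist_real_def by auto
  have "\<forall>\<^sub>F z in near (V \<times> UNIV) (coords x). dist (sqdist u v z) t < \<eta> / 2"
    unfolding x(2)[symmetric]
    by (rule tendstoD[OF tendsto_near_ratpoly[OF sqdist_in_ratpoly[OF uv]]]) (use \<eta>(1) in simp)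
  with P(1) have "\<forall>\<^sub>F z in near (V \<times> UNIV) (coords x). P1 z \<and> dist (sqdist u v z) t < \<eta> / 2"
    by (rule eventually_conj)
  from eventually_near_coords[OF this] obtain e1 where e1: "e1 > 0"
    "\<And>q. \<forall>w\<in>V. dist (q w) (x w) < e1 \<Longrightarrow> P1 (coords q) \<and> dist (sqdist u v (coords q)) t < \<eta> / 2"
    by auto
  have t_le: "t \<le> sqdist u v (coords q)" if "equivalent E x q" for q
  proof -
    have "equivalent E p q" using x(1) that unfolding equivalent_def by auto
    then show ?thesis unfolding t_def by (intro mn_le[OF p]) (auto simp: Val_def)
  qed
  have "\<exists>e>0. \<forall>p' q. (\<forall>w\<in>V. dist (p' w) (x w) < e) \<longrightarrow> equivalent E p' q \<longrightarrow>
      t - \<eta> / 2 \<le> sqdist u v (coords q)"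
    using \<eta>(1) by (intro fibre_minimum_lower_semicontinuous[OF G rig uv] t_le) auto
  then obtain e2 where e2: "e2 > 0" "\<And>p' q. \<forall>w\<in>V. dist (p' w) (x w) < e2 \<Longrightarrow> equivalent E p' q \<Longrightarrow>
    t - \<eta> / 2 \<le> sqdist u v (coords q)" by auto
  obtain p' :: "'a \<Rightarrow> real^'d" where p': "generic V p'" "\<forall>w\<in>V. dist (p' w) (x w) < min e1 e2"
    using generic_dense[OF V, of "min e1 e2" x] e1(1) e2(1) by auto
  have P1': "P1 (coords p')" and near_t: "\<bar>sqdist u v (coords p') - t\<bar> < \<eta> / 2"
    using e1(2)[of p'] p'(2) by (auto simp: dist_real_def)
  have low: "t - \<eta> / 2 \<le> s" if "s \<in> Val p'" for s
    using that e2(2)[of p'] p'(2) by (auto simp: Val_def)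
  let ?t = "mn p'"
  have t': "\<bar>?t - t\<bar> < \<eta>"
    using low[OF mn_in[OF p'(1)]] mn_le[OF p'(1) self] near_t \<eta>(1) by linarith
  \<comment> \<open>By the choice of \<open>p\<close>, the root \<open>?t\<close> has order at least
    \<open>mult p\<close>. A second root in the window would force a zero of the derivative of order
    \<open>mult p\<close> there.\<close>
  have unique: "s = ?t" if s: "s \<in> Val p'" "s < t + \<eta>" for s
  proof (rule ccontr)
    assume "s \<noteq> ?t"
    moreover have "poly (A p') s = 0" using s(1) root A_eq by (force simp: Val_def)
    moreover have "poly ((Polynomial.pderiv ^^ i) (A p')) ?t = 0" if "i < mult p" for i
      using below_mult[of i p'] least[OF p'(1)] that by auto
    ultimately obtain y where y: "min s ?t \<le> y" "y \<le> max s ?t" "?D p' y = 0"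
      using higher_pderiv_root_between[of "mult p" "A p'" ?t s] by auto
    have "\<bar>y - t\<bar> < \<eta>" using y(1,2) t' low[OF s(1)] s(2) \<eta>(1) by (auto simp: max_def min_def split: if_splits)
    then have "?D (config (coords p')) y \<noteq> 0" using \<eta>(2) by (intro P(3)[OF P1']) auto
    then show False using y(3) by simp
  qed
  have eq: "sqdist u v (coords p') = ?t" using near_t \<eta>(1) by (intro unique self) linarith
  show ?thesis
  proof (intro exI[of _ p'] exI[of _ "\<eta> / 2"] conjI allI impI)
    fix q assume "equivalent E p' q"
    then have "sqdist u v (coords q) \<in> Val p'" by (auto simp: Val_def)
    then show "sqdist u v (coords q) = sqdist u v (coords p') \<or>
        sqdist u v (coords p') + \<eta> / 2 \<le> sqdist u v (coords q)"
      using unique[of "sqdist u v (coords q)"] eq near_t by linarith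
  qed (use p'(1) \<eta>(1) in auto)
qed

subsection \<open>Decomposition along cliques\<close>

lemma is_graph_induced_edges: "is_graph V E \<Longrightarrow> S \<subseteq> V \<Longrightarrow> is_graph S (induced_edges E S)"
  unfolding is_graph_def induced_edges_def by (auto intro: finite_subset) (metis insert_subset)

text \<open>Placing the path next to u bounds the distance between u and v in every equivalent framework
  from above by little more than the minimum it takes on the fibre of the rigid subgraph.\<close>

lemma weakly_globally_linked_if_outside_path:
  fixes V :: "'a set"
  assumes G: "is_graph V E" and S: "S \<subseteq> V" and rig: "rigid_graph TYPE('d::finite) S (induced_edges E S)"
    and uv: "u \<in> S" "v \<in> S" and w: "w1 \<in> V - S" "w2 \<in> V - S" "{u, w1} \<in> E" "{w2, v} \<in> E"
    and path: "(w1, w2) \<in> {(a, b). a \<in> V - S \<and> b \<in> V - S \<and> {a, b} \<in> E}\<^sup>*"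
  shows "weakly_globally_linked TYPE('d) V E u v"
proof -
  define R where "R = {(a, b). a \<in> V - S \<and> b \<in> V - S \<and> {a, b} \<in> E}"
  have V: "finite V" using G by (simp add: is_graph_def)
  obtain n where n: "(w1, w2) \<in> R ^^ n"
    using path rtrancl_power unfolding R_def by blast
  obtain p0 :: "'a \<Rightarrow> real^'d" and \<delta> where p0: "generic S p0" "\<delta> > 0"
    "\<And>q. equivalent (induced_edges E S) p0 q \<Longrightarrow> sqdist u v (coords q) = sqdist u v (coords p0) \<or>
       sqdist u v (coords p0) + \<delta> \<le> sqdist u v (coords q)"
    using generic_fibre_minimizer[OF is_graph_induced_edges[OF G S] rig uv] by auto
  define D where "D = dist (p0 u) (p0 v)"
  \<comment> \<open>The edge at \<open>u\<close> costs at most \<open>\<rho>\<close>, each of the n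
    path edges \<open>2 * \<rho>\<close>, and the edge at \<open>v\<close> at most
    \<open>\<rho> + D\<close>. The total \<open>D + (2n+2) \<rho>\<close> is below the next possible
    distance \<open>sqrt (D^2 + \<delta>)\<close>; 3 in place of 2 makes this strict.\<close>
  define \<rho> where "\<rho> = (sqrt (D\<^sup>2 + \<delta>) - D) / (2 * of_nat n + 3)"
  have D0: "0 \<le> D" by (simp add: D_def)
  have "D < sqrt (D\<^sup>2 + \<delta>)" using p0(2) by (intro real_less_rsqrt) auto
  then have \<rho>: "\<rho> > 0" by (simp add: \<rho>_def add_nonneg_pos)
  have \<rho>eq: "(2 * of_nat n + 3) * \<rho> = sqrt (D\<^sup>2 + \<delta>) - D"
    unfolding \<rho>_def by (simp add: add_nonneg_eq_0_iff)
  obtain p :: "'a \<Rightarrow> real^'d" where p: "generic V p" "\<forall>w\<in>S. p w = p0 w" "\<forall>w\<in>V - S. dist (p w) (p0 u) < \<rho>"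
    using generic_extend[OF V S p0(1) \<rho>, of "\<lambda>_. p0 u"] by auto
  have "dist (q u) (q v) = dist (p u) (p v)" if q: "equivalent E p q" for q
  proof -
    have E: "dist (q a) (q b) = dist (p a) (p b)" if "{a, b} \<in> E" for a b
      using q that by (simp add: equivalent_def)
    have walk: "dist (q w1) (q b) \<le> of_nat k * (2 * \<rho>)" if "(w1, b) \<in> R ^^ k" for k b
      using that
    proof (induction k arbitrary: b)
      case (Suc k)
      then obtain a where a: "(w1, a) \<in> R ^^ k" "(a, b) \<in> R" by auto
      have "dist (q a) (q b) = dist (p a) (p b)" using a(2) E by (auto simp: R_def)
      also have "\<dots> \<le> dist (p a) (p0 u) + dist (p b) (p0 u)" by (rule dist_triangle2)
      also have "\<dots> \<le> 2 * \<rho>"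
        using p(3)[rule_format, of a] p(3)[rule_format, of b] a(2) by (auto simp: R_def)
      finally have "dist (q a) (q b) \<le> 2 * \<rho>" .
      then have "dist (q w1) (q b) \<le> of_nat k * (2 * \<rho>) + 2 * \<rho>"
        using Suc.IH[OF a(1)] dist_triangle[of "q w1" "q b" "q a"] by linarith
      then show ?case by (simp add: algebra_simps)
    qed simp
    have "dist (q u) (q w1) \<le> \<rho>"
      using E[OF w(3)] p(2,3) uv w(1) by (simp add: dist_commute less_imp_le)
    moreover have "dist (q w2) (q v) \<le> \<rho> + D"
    proof -
      have "dist (p w2) (p v) \<le> dist (p w2) (p0 u) + D"
        using dist_triangle[of "p w2" "p v" "p0 u"] p(2) uv by (simp add: D_def)
      then show ?thesis using E[OF w(4)] p(3)[rule_format, OF w(2)] by linarith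
    qed
    ultimately have "dist (q u) (q v) \<le> \<rho> + (of_nat n * (2 * \<rho>) + (\<rho> + D))"
      using walk[OF n] dist_triangle[of "q u" "q v" "q w1"] dist_triangle[of "q w1" "q v" "q w2"]
      by linarith
    also have "\<dots> < (2 * of_nat n + 3) * \<rho> + D" using \<rho> by (simp add: algebra_simps)
    also have "\<dots> = sqrt (D\<^sup>2 + \<delta>)" using \<rho>eq by simp
    finally have "(dist (q u) (q v))\<^sup>2 < (sqrt (D\<^sup>2 + \<delta>))\<^sup>2" by (intro power_strict_mono) auto
    then have less: "sqdist u v (coords q) < sqdist u v (coords p0) + \<delta>"
      using p0(2) by (simp add: sqdist_coords D_def)
    have "equivalent (induced_edges E S) p0 q"
      using p(2) E by (auto simp: equivalent_def induced_edges_def)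
    from p0(3)[OF this] less have "sqdist u v (coords q) = sqdist u v (coords p0)" by auto
    then have "dist (q u) (q v) = dist (p0 u) (p0 v)" unfolding dist_eq_iff_sqdist_eq .
    then show ?thesis using p(2) uv by simp
  qed
  then show ?thesis unfolding weakly_globally_linked_def using p(1) by auto
qed

text \<open>A generic framework that witnesses weak linkedness in the subgraph extends to a generic
  one of the whole graph, and every framework equivalent to the extension is equivalent on the
  subgraph.\<close>

lemma totally_loose_induced:
  fixes V :: "'a set"
  assumes G: "is_graph V E" and S: "S \<subseteq> V" and tl: "totally_loose TYPE('d::finite) V E"
  shows "totally_loose TYPE('d) S (induced_edges E S)"
  unfolding totally_loose_def globally_loose_def
proof (intro ballI impI notI)
  fix u v assume uv: "u \<in> S" "v \<in> S" "u \<noteq> v \<and> {u, v} \<notin> induced_edges E S"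
    and wl: "weakly_globally_linked TYPE('d) S (induced_edges E S) u v"
  have V: "finite V" using G by (simp add: is_graph_def)
  obtain p :: "'a \<Rightarrow> real^'d" where p: "generic S p"
    "\<And>q. equivalent (induced_edges E S) p q \<Longrightarrow> dist (q u) (q v) = dist (p u) (p v)"
    using wl unfolding weakly_globally_linked_def by auto
  obtain r :: "'a \<Rightarrow> real^'d" where r: "generic V r" "\<forall>w\<in>S. r w = p w"
    using generic_extend[OF V S p(1), of 1 p] by auto
  have "dist (q u) (q v) = dist (r u) (r v)" if "equivalent E r q" for q
  proof -
    have "equivalent (induced_edges E S) p q"
      unfolding equivalent_def
    proof (intro allI impI)
      fix a b assume "{a, b} \<in> induced_edges E S"
      then have "{a, b} \<in> E" "a \<in> S" "b \<in> S" by (auto simp: induced_edges_def)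
      then show "dist (p a) (p b) = dist (q a) (q b)"
        using that r(2) unfolding equivalent_def by (metis (no_types))
    qed
    then show ?thesis using p(2) r(2) uv by simp
  qed
  then have "weakly_globally_linked TYPE('d) V E u v"
    unfolding weakly_globally_linked_def using r(1) by auto
  moreover have "{u, v} \<notin> E" using uv by (auto simp: induced_edges_def)
  ultimately show False using tl uv S unfolding totally_loose_def globally_loose_def by blast
qed

theorem theorem4p3:
  fixes V :: "'a set" and E :: "'a set set"
  assumes "is_graph V E"
    and "rigid_graph TYPE('d::finite) V E"
    and "totally_loose TYPE('d) V E"
  shows "clique_sum_of_special TYPE('d) V E"
  using assms
proof (induction "card V" arbitrary: V E rule: less_induct)
  case less
  note G = less.prems(1) and rig = less.prems(2) and tl = less.prems(3)
  have V: "finite V" using G by (simp add: is_graph_def)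
  show ?case
  proof (cases "special TYPE('d) V E")
    case True
    then show ?thesis by (rule clique_sum_of_special.base[OF G])
  next
    case False
    then obtain S where S: "S \<subset> V" "rigid_graph TYPE('d) S (induced_edges E S)" "\<not> is_clique E S"
      using rig unfolding special_def by auto
    define R where "R = {(a, b). a \<in> V - S \<and> b \<in> V - S \<and> {a, b} \<in> E}"
    obtain w0 where w0: "w0 \<in> V - S" using S(1) by auto
    define C where "C = {w. (w0, w) \<in> R\<^sup>*}"
    define N where "N = {s \<in> S. \<exists>c\<in>C. {s, c} \<in> E}"
    have C: "c \<in> V - S" if "c \<in> C" for c
    proof -
      have "(w0, c) \<in> R\<^sup>*" using that by (simp add: C_def)
      then show ?thesis by (induction rule: rtrancl_induct) (use w0 in \<open>auto simp: R_def\<close>)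
    qed
    have w0C: "w0 \<in> C" by (simp add: C_def)
    have "sym R" by (auto simp: R_def sym_def insert_commute)
    then have connC: "(c, c') \<in> R\<^sup>*" if "c \<in> C" "c' \<in> C" for c c'
      using that sym_rtrancl[of R] unfolding C_def by (auto dest: symD intro: rtrancl_trans)
    have N: "is_clique E N"
      unfolding is_clique_def
    proof (intro ballI impI, rule ccontr)
      fix u v assume uv: "u \<in> N" "v \<in> N" "u \<noteq> v" "{u, v} \<notin> E"
      obtain c c' where c: "c \<in> C" "{u, c} \<in> E" "c' \<in> C" "{v, c'} \<in> E"
        using uv by (auto simp: N_def)
      have "weakly_globally_linked TYPE('d) V E u v"
      proof (rule weakly_globally_linked_if_outside_path[OF G _ S(2)])
        show "(c, c') \<in> {(a, b). a \<in> V - S \<and> b \<in> V - S \<and> {a, b} \<in> E}\<^sup>*"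
          using connC[OF c(1,3)] unfolding R_def .
      qed (use S(1) uv c C in \<open>auto simp: N_def insert_commute\<close>)
      then show False
        using tl uv S(1) unfolding totally_loose_def globally_loose_def N_def by blast
    qed
    define V1 V2 where "V1 = V - C" and "V2 = C \<union> N"
    define E1 E2 where "E1 = induced_edges E V1" and "E2 = induced_edges E V2"
    have sub: "V1 \<subseteq> V" "V2 \<subseteq> V" using C S(1) by (auto simp: V1_def V2_def N_def)
    have union: "V1 \<union> V2 = V" using sub by (auto simp: V1_def V2_def)
    have inter: "V1 \<inter> V2 = N" using C S(1) by (auto simp: V1_def V2_def N_def)
    have boundary: "b \<in> N" if ab: "{a, b} \<in> E" "a \<in> C" "b \<notin> C" for a b
    proof -
      have bV: "b \<in> V" using is_graph_edgeD[OF G ab(1)] by simp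
      have "b \<in> S"
      proof (rule ccontr)
        assume "b \<notin> S"
        then have "(a, b) \<in> R" using bV C[OF ab(2)] ab(1) by (simp add: R_def)
        then have "b \<in> C" using ab(2) by (auto simp: C_def intro: rtrancl_into_rtrancl)
        then show False using ab(3) by simp
      qed
      then show ?thesis using ab by (auto simp: N_def insert_commute)
    qed
    have edges: "E1 \<union> E2 = E"
    proof (intro equalityI subsetI)
      fix e assume e: "e \<in> E"
      then obtain a b where ab: "e = {a, b}" "a \<in> V" "b \<in> V"
        using G unfolding is_graph_def by blast
      have "{b, a} \<in> E" using e ab(1) by (simp add: insert_commute)
      then show "e \<in> E1 \<union> E2"
        using e ab boundary[of a b] boundary[of b a]
        by (auto simp: E1_def E2_def induced_edges_def V1_def V2_def)
    qed (auto simp: E1_def E2_def induced_edges_def)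
    have G12: "is_graph V1 E1" "is_graph V2 E2"
      unfolding E1_def E2_def using is_graph_induced_edges[OF G] sub by auto
    have cl: "is_clique E1 (V1 \<inter> V2)" "is_clique E2 (V1 \<inter> V2)"
      using N unfolding inter unfolding is_clique_def E1_def E2_def induced_edges_def inter[symmetric]
      by auto
    have rig1: "rigid_graph TYPE('d) V1 E1"
      using rigid_graph_clique_sum_side[OF G12 cl(1)] rig by (simp add: union edges)
    have rig2: "rigid_graph TYPE('d) V2 E2"
      using rigid_graph_clique_sum_side[OF G12(2,1)] cl(2) rig
      by (simp add: union edges Un_commute[of V2] Un_commute[of E2] Int_commute[of V2])
    \<comment> \<open>The empty set is a clique, so \<open>S\<close> has a vertex outside
      \<open>C\<close>. The resulting edge leaving \<open>C\<close> ends in \<open>N\<close>, which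
      makes the overlap nonempty.\<close>
    have "S \<noteq> {}" using S(3) by (auto simp: is_clique_def)
    then have "C \<noteq> V" using C S(1) by blast
    then obtain a b where "a \<in> C" "b \<in> V - C" "{a, b} \<in> E"
      using rigid_graph_cut_edge[OF G rig, of C] C w0C by blast
    then have "V1 \<inter> V2 \<noteq> {}" using boundary inter by auto
    \<comment> \<open>Subsets of a clique are cliques, so some vertex of the non-complete
      \<open>S\<close> is missing from \<open>V2\<close>; this makes the second side
      smaller.\<close>
    have "\<not> S \<subseteq> N" using S(3) N unfolding is_clique_def by blast
    then have "V2 \<subset> V" using sub(2) C S(1) by (auto simp: V2_def)
    then have card2: "card V2 < card V" by (rule psubset_card_mono[OF V])
    have "V1 \<subset> V" using w0 w0C by (auto simp: V1_def)
    then have card1: "card V1 < card V" by (rule psubset_card_mono[OF V])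
    have "clique_sum_of_special TYPE('d) V1 E1"
      by (rule less.hyps[OF card1 G12(1) rig1]) (unfold E1_def, rule totally_loose_induced[OF G sub(1) tl])
    moreover have "clique_sum_of_special TYPE('d) V2 E2"
      by (rule less.hyps[OF card2 G12(2) rig2]) (unfold E2_def, rule totally_loose_induced[OF G sub(2) tl])
    ultimately have "clique_sum_of_special TYPE('d) (V1 \<union> V2) (E1 \<union> E2)"
      using \<open>V1 \<inter> V2 \<noteq> {}\<close> cl by (rule clique_sum_of_special.sum)
    then show ?thesis by (simp add: union edges)
  qed
qed

end
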